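(* Let $A$ be the Sierpiński carpet in $\mathbb{R}^2$, constructed in the usual way inside the unit square, and let $\delta>1/6$ be fixed. Then $\zeta_A$ has a meromorphic continuation to all of $\mathbb{C}$ given by $$\zeta_A(s)=\frac{8}{2^s\,s(s-1)(3^s-8)}+2\pi\frac{\delta^s}{s}+4\frac{\delta^{s-1}}{s-1}.$$ Hence, the set of principal complex dimensions of $A$ is $$\dim_{PC}A=\log_38+\frac{2\pi}{\log3}\,i\,\mathbb{Z}$$ and consists only of simple poles of $\zeta_A$. Also, the residues of $\zeta_A$ at the principal poles $s_k:=\log_38+\frac{2\pi}{\log3}ki\in\dim_{PC}A$, $k\in\mathbb{Z}$, are given by $$\operatorname{res}(\zeta_A,s_k)=\frac{2^{-s_k}}{(\log3)\,s_k(s_k-1)}.$$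
   Context: The Sierpiński carpet is the compact set obtained from $[0,1]^2$ by dividing it into $9$ congruent squares of side $1/3$, deleting the open middle one, repeating the procedure in each of the remaining $8$ closed squares, and so on ad infinitum (so in the $k$-th generation $8^{k-1}$ open squares of side $3^{-k}$ are deleted), and intersecting all the resulting sets. For bounded $A\subset\mathbb{R}^2$ and $\delta>0$, $A_\delta=\{x\in\mathbb{R}^2:d(x,A)<\delta\}$ ($d$ Euclidean distance), and the distance zeta function is $\zeta_A(s)=\int_{A_\delta}d(x,A)^{s-2}\,dx$ for $\operatorname{Re}s$ sufficiently large; its meromorphic continuation is denoted by the same symbol. $D(\zeta_A)=\inf\{\sigma\ge0:\int_{A_\delta}d(x,A)^{\sigma-2}dx<\infty\}$ is the abscissa of convergence, and $\dim_{PC}A$ (the set of principal complex dimensions) is the set of poles of $\zeta_A$ on the critical line $\{\operatorname{Re}s=D(\zeta_A)\}$. $\operatorname{res}(f,\omega)$ denotes the residue of $f$ at $\omega$. *)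

theory Defs
  imports "HOL-Complex_Analysis.Complex_Analysis"
begin

text \<open>The plane is \<^typ>\<open>real \<times> real\<close>, whose library metric is the Euclidean one and whose
  \<^const>\<open>lborel\<close> is two-dimensional Lebesgue measure.\<close>

text \<open>Lower left corners of the closed squares of side \<open>1 / 3 ^ n\<close> that remain after \<open>n\<close> steps.\<close>

fun carpet_corners :: "nat \<Rightarrow> (real \<times> real) set" where
  "carpet_corners 0 = {(0, 0)}"
| "carpet_corners (Suc n) =
     {(x + real i / 3 ^ Suc n, y + real j / 3 ^ Suc n) | x y i j.
        (x, y) \<in> carpet_corners n \<and> i \<le> 2 \<and> j \<le> 2 \<and> (i, j) \<noteq> (1, 1)}"

fun carpet_stage :: "nat \<Rightarrow> (real \<times> real) set" where
  "carpet_stage 0 = cbox (0, 0) (1, 1)"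
| "carpet_stage (Suc n) =
     carpet_stage n -
       (\<Union>(x, y)\<in>carpet_corners n.
          box (x + 1 / 3 ^ Suc n, y + 1 / 3 ^ Suc n) (x + 2 / 3 ^ Suc n, y + 2 / 3 ^ Suc n))"

definition sierpinski_carpet :: "(real \<times> real) set" where
  "sierpinski_carpet = (\<Inter>n. carpet_stage n)"

definition nbhd :: "(real \<times> real) set \<Rightarrow> real \<Rightarrow> (real \<times> real) set" where
  "nbhd A \<delta> = {x. infdist x A < \<delta>}"

definition zeta_integrand :: "(real \<times> real) set \<Rightarrow> complex \<Rightarrow> real \<times> real \<Rightarrow> complex" where
  "zeta_integrand A s x = of_real (infdist x A) powr (s - 2)"

definition distance_zeta :: "(real \<times> real) set \<Rightarrow> real \<Rightarrow> complex \<Rightarrow> complex" where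
  "distance_zeta A \<delta> s = (LINT x:nbhd A \<delta>|lborel. zeta_integrand A s x)"

text \<open>Since \<open>0 powr a = 0\<close> in the library, the value \<open>\<infinity>\<close> of the integrand at points of distance \<open>0\<close>
  (for \<open>\<sigma> < 2\<close>) has to be put in by hand; it matters for sets of positive measure.\<close>

definition abscissa :: "(real \<times> real) set \<Rightarrow> real \<Rightarrow> real" where
  "abscissa A \<delta> = Inf {\<sigma>. 0 \<le> \<sigma> \<and>
     (\<integral>\<^sup>+x\<in>nbhd A \<delta>. (if infdist x A = 0 \<and> \<sigma> < 2 then \<infinity>
                       else ennreal (infdist x A powr (\<sigma> - 2))) \<partial>lborel) < \<infinity>}"

text \<open>\<open>Z\<close> is a meromorphic continuation of the distance zeta function to the domain \<open>U\<close>. It is unique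
  up to its values on a discrete set, so its poles, their orders and its residues depend only on
  \<open>A\<close> and \<open>\<delta>\<close>. Integrability is required because the Bochner integral of a non-integrable
  function is \<open>0\<close> by convention.\<close>

definition zeta_continuation ::
  "(real \<times> real) set \<Rightarrow> real \<Rightarrow> complex set \<Rightarrow> (complex \<Rightarrow> complex) \<Rightarrow> bool" where
  "zeta_continuation A \<delta> U Z \<longleftrightarrow>
     open U \<and> connected U \<and> {s. Re s > abscissa A \<delta>} \<subseteq> U \<and> Z meromorphic_on U \<and>
     (\<forall>s. Re s > abscissa A \<delta> \<longrightarrow>
        set_integrable lborel (nbhd A \<delta>) (zeta_integrand A s) \<and> Z s = distance_zeta A \<delta> s)"

definition principal_complex_dims :: "(real \<times> real) set \<Rightarrow> real \<Rightarrow> complex set" where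
  "principal_complex_dims A \<delta> =
     {\<omega>. Re \<omega> = abscissa A \<delta> \<and>
        (\<exists>U Z. {s. Re s \<ge> abscissa A \<delta>} \<subseteq> U \<and> zeta_continuation A \<delta> U Z \<and> is_pole Z \<omega>)}"

end

theory Submission
  imports Defs "HOL-Real_Asymp.Real_Asymp"
begin

text \<open>Up to the carpet itself, which is a null set because the deleted squares have total area \<open>1\<close>,
  the neighbourhood is the disjoint union of the outer collar of the unit square and of the deleted
  squares (all of them, since \<open>\<delta> > 1 / 6\<close>). On each piece the area of \<open>{t < d}\<close>, where \<open>d\<close> is the
  distance to the carpet, is a quadratic polynomial in \<open>t\<close>: the set is a concentric smaller square,
  respectively a collar of area \<open>4 (\<delta> - t) + \<pi> (\<delta>\<^sup>2 - t\<^sup>2)\<close>. So \<open>d\<close> has a piecewise linear density, the zeta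
  integral over a piece is elementary, and the contributions of the deleted squares form a geometric
  series of ratio \<open>8 / 3 powr s\<close>. Poles and residues of any continuation are then read off from the
  closed form by the identity theorem.\<close>

section \<open>Power moments of a distance function\<close>

text \<open>A finite measure on the line is determined by its values on the rays
  \<open>{t<..}\<close>, so the areas of the sets {t < d} identify the push-forward of Lebesgue
  measure under d without any coarea formula. The density is positive at 0, so each single piece
  already asks for Re s > 1; the critical exponent \<open>log 3 8\<close> exceeds 1, and the pieces
  stay elementary on the whole half-plane of convergence. Inside a hole the distance to the carpet
  is the distance to the edges of that hole, because these edges are never deleted. This and the
  disjointness of holes of different generations are the geometric core. The closed squares of the
  construction share edges, so the combinatorics is done with half-open cells, where a point
  determines its cell by a floor. The abscissa is an infimum over nonnegative integrals, whereas the
  zeta function is a Bochner integral. The moments are therefore needed in both forms, the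
  nonnegative one also for divergence at and below the critical exponent.\<close>

lemma complex_powr_moment:
  fixes s :: complex and h :: real
  assumes "Re s > 0" "h > 0"
  shows "set_integrable lborel {0..h} (\<lambda>t. of_real t powr (s - 1))"
    and "(LINT t:{0..h}|lborel. of_real t powr (s - 1)) = of_real h powr s / s"
proof -
  have s: "s \<noteq> 0"
    using assms by auto
  \<comment> \<open>At t = 0 both sides are 0 by the convention \<open>0 powr a = 0\<close>.\<close>
  have *: "norm (of_real t powr (s - 1) :: complex) = t powr (Re s - 1)" if "t \<ge> 0" for t :: real
    using that by (cases "t = 0") (auto simp: norm_powr_real_powr)
  have "((\<lambda>t. t powr (Re s - 1)) has_integral (h powr (Re s - 1 + 1) / (Re s - 1 + 1))) {0..h}"
    using assms by (intro has_integral_powr_from_0) auto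
  then have "(\<integral>\<^sup>+t. indicator {0..h} t * t powr (Re s - 1) \<partial>lborel)
             = ennreal (h powr (Re s - 1 + 1) / (Re s - 1 + 1))"
    by (intro nn_integral_has_integral_lebesgue) auto
  moreover have "norm (indicator {0..h} t *\<^sub>R (of_real t powr (s - 1) :: complex))
      = indicator {0..h} t * t powr (Re s - 1)" for t
    using * by (auto simp: indicator_def)
  ultimately show int: "set_integrable lborel {0..h} (\<lambda>t. of_real t powr (s - 1))"
    unfolding set_integrable_def by (intro integrableI_bounded) (simp, simp only: infinity_ennreal_def ennreal_less_top)
  \<comment> \<open>The improper form of the fundamental theorem is used: for Re s < 1 the integrand
    is unbounded at 0, and the antiderivative only needs one-sided limits at the two ends.\<close>
  have "(LBINT t=ereal 0..ereal h. of_real t powr (s - 1)) = of_real h powr s / s - 0"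
  proof (rule interval_integral_FTC_integrable)
    show "ereal 0 < ereal h"
      using assms by simp
    show "set_integrable lborel (einterval (ereal 0) (ereal h)) (\<lambda>t. of_real t powr (s - 1))"
      by (rule set_integrable_subset[OF int]) (auto simp: einterval_def)
    show "((\<lambda>t. of_real t powr s / s) has_vector_derivative of_real t powr (s - 1)) (at t)"
      if "ereal 0 < ereal t" for t
    proof -
      have "((\<lambda>z. z powr s / s) has_field_derivative of_real t powr (s - 1)) (at (of_real t))"
        using that s by (auto intro!: derivative_eq_intros)
      from field_vector_diff_chain_at[OF has_vector_derivative_of_real[OF DERIV_ident], unfolded o_def, OF this]
      show ?thesis by simp
    qed
    show "isCont (\<lambda>t. of_real t powr (s - 1) :: complex) t" if "ereal 0 < ereal t" for t
      using that by (intro continuous_intros) auto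
    show "(((\<lambda>t. of_real t powr s / s) \<circ> real_of_ereal) \<longlongrightarrow> 0) (at_right (ereal 0))"
    proof -
      have "((\<lambda>t. t powr Re s) \<longlongrightarrow> 0) (at_right 0)"
        using assms by real_asymp
      then have "((\<lambda>t. norm (of_real t powr s :: complex)) \<longlongrightarrow> 0) (at_right (0::real))"
        by (rule Lim_transform_eventually)
          (use assms in \<open>auto intro!: eventually_mono[OF eventually_at_right_less] simp: norm_powr_real_powr\<close>)
      then have "((\<lambda>t. of_real t powr s / s) \<longlongrightarrow> 0) (at_right (0::real))"
        by (auto intro!: tendsto_divide_zero simp: tendsto_norm_zero_iff)
      then show ?thesis
        by (simp add: ereal_tendsto_simps1)
    qed
    show "(((\<lambda>t. of_real t powr s / s) \<circ> real_of_ereal) \<longlongrightarrow> of_real h powr s / s) (at_left (ereal h))"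
    proof -
      have "((\<lambda>t. of_real t powr s / s) \<longlongrightarrow> of_real h powr s / s) (at_left h)"
        using assms s by (intro tendsto_intros) auto
      then show ?thesis
        by (simp add: ereal_tendsto_simps1)
    qed
  qed
  then show "(LINT t:{0..h}|lborel. of_real t powr (s - 1)) = of_real h powr s / s"
    using assms by (simp add: interval_integral_Icc)
qed

text \<open>The expression a (h - t) + b (h^2 - t^2) / 2 is the integral of a + b u over [t, h].
  Both measures thus take the same finite value on every ray \<open>{t<..}\<close>, and the rays
  determine them.\<close>

lemma distr_eq_linear_density:
  fixes d :: "'a::euclidean_space \<Rightarrow> real"
  assumes [measurable]: "P \<in> sets borel" "d \<in> borel_measurable borel"
    and h: "0 \<le> h" and d: "\<And>x. x \<in> P \<Longrightarrow> 0 < d x \<and> d x \<le> h"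
    and nonneg: "\<And>t. 0 \<le> t \<Longrightarrow> t \<le> h \<Longrightarrow> 0 \<le> a + b * t"
    and level: "\<And>t. 0 \<le> t \<Longrightarrow> t \<le> h \<Longrightarrow>
      emeasure lborel {x \<in> P. t < d x} = ennreal (a * (h - t) + b * (h\<^sup>2 - t\<^sup>2) / 2)"
  shows "distr (density lborel (\<lambda>x. ennreal (indicator P x))) borel d
       = density lborel (\<lambda>t. ennreal (indicator {0..h} t * (a + b * t)))" (is "?M = ?N")
proof (rule measure_eqI_lessThan)
  have M: "emeasure ?M {t<..} = emeasure lborel {x \<in> P. t < d x}" for t
  proof -
    have "emeasure ?M {t<..} = (\<integral>\<^sup>+x. ennreal (indicator P x) * indicator {x. t < d x} x \<partial>lborel)"
      by (simp add: emeasure_distr emeasure_density vimage_def)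
    also have "\<dots> = (\<integral>\<^sup>+x. indicator {x \<in> P. t < d x} x \<partial>lborel)"
      by (intro nn_integral_cong) (auto simp: indicator_def)
    finally show ?thesis by simp
  qed
  \<comment> \<open>Clamping t to [0, h] does not change {t < d} on \<open>P\<close>, since d takes
    its values in (0, h] there; this extends the area formula to all real t.\<close>
  define c where "c t = max 0 (min t h)" for t :: real
  have c: "0 \<le> c t" "c t \<le> h" for t
    using h by (auto simp: c_def)
  have P: "emeasure lborel {x \<in> P. t < d x} = ennreal (a * (h - c t) + b * (h\<^sup>2 - (c t)\<^sup>2) / 2)" for t
  proof -
    have "{x \<in> P. t < d x} = {x \<in> P. c t < d x}"
      using d h by (force simp: c_def)
    then show ?thesis using level[OF c] by simp
  qed
  show "emeasure ?M {t<..} < \<infinity>" for t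
    by (simp add: M P)
  show "emeasure ?M {t<..} = emeasure ?N {t<..}" for t
  proof -
    \<comment> \<open>The ray is open at t but the interval on the right contains its left end, so
      one point has to be excluded.\<close>
    have "ennreal (indicator {0..h} u * (a + b * u)) * indicator {t<..} u
        = ennreal (a + b * u) * indicator {c t..h} u" if "u \<noteq> c t" for u
      using h that by (auto simp: indicator_def c_def)
    then have "emeasure ?N {t<..} = (\<integral>\<^sup>+u. ennreal (a + b * u) * indicator {c t..h} u \<partial>lborel)"
      using AE_lborel_singleton[of "c t"] h
      by (subst emeasure_density) (auto intro!: nn_integral_cong_AE)
    also have "\<dots> = ennreal ((a * h + b * h\<^sup>2 / 2) - (a * c t + b * (c t)\<^sup>2 / 2))"
      using c nonneg by (intro nn_integral_FTC_Icc)
        (auto intro!: derivative_eq_intros simp: has_real_derivative_iff_has_vector_derivative[symmetric] order_trans[OF c(1)])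
    finally show ?thesis
      unfolding M P by (simp add: algebra_simps diff_divide_distrib)
  qed
qed auto

text \<open>Pushing forward along d turns the integral into one over [0, h] against a + b t. The
  constant part is a power moment with s - 1 in place of s, which is why Re s > 1 is assumed; the
  linear part raises the exponent by one.\<close>

lemma distance_moment:
  fixes d :: "'a::euclidean_space \<Rightarrow> real" and s :: complex
  assumes [measurable]: "P \<in> sets borel" "d \<in> borel_measurable borel"
    and h: "0 < h" and d: "\<And>x. x \<in> P \<Longrightarrow> 0 < d x \<and> d x \<le> h"
    and nonneg: "\<And>t. 0 \<le> t \<Longrightarrow> t \<le> h \<Longrightarrow> 0 \<le> a + b * t"
    and level: "\<And>t. 0 \<le> t \<Longrightarrow> t \<le> h \<Longrightarrow>
      emeasure lborel {x \<in> P. t < d x} = ennreal (a * (h - t) + b * (h\<^sup>2 - t\<^sup>2) / 2)"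
    and s: "Re s > 1"
  shows "set_integrable lborel P (\<lambda>x. of_real (d x) powr (s - 2))" (is ?int)
    and "(LINT x:P|lborel. of_real (d x) powr (s - 2))
         = of_real a * (of_real h powr (s - 1) / (s - 1)) + of_real b * (of_real h powr s / s)" (is ?eq)
proof -
  let ?f = "\<lambda>t::real. of_real t powr (s - 2) :: complex"
  have D: "distr (density lborel (\<lambda>x. ennreal (indicator P x))) borel d
       = density lborel (\<lambda>t. ennreal (indicator {0..h} t * (a + b * t)))"
    using h d nonneg level by (intro distr_eq_linear_density) auto
  note I = complex_powr_moment[of "s - 1" h] complex_powr_moment[of s h]
  have eq: "(indicator {0..h} t * (a + b * t)) *\<^sub>R ?f t
     = of_real a * (indicator {0..h} t *\<^sub>R of_real t powr (s - 1 - 1))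
     + of_real b * (indicator {0..h} t *\<^sub>R of_real t powr (s - 1))" for t
  proof (cases "t \<in> {0..h} \<and> t \<noteq> 0")
    case True
    then have "of_real t powr (s - 1) = of_real t * ?f t"
      using powr_add[of "of_real t" 1 "s - 2"] by (simp add: algebra_simps)
    with True show ?thesis by (simp add: scaleR_conv_of_real algebra_simps)
  qed (auto simp: indicator_def)
  have int: "integrable lborel (\<lambda>t. (indicator {0..h} t * (a + b * t)) *\<^sub>R ?f t)"
    unfolding eq using I s h unfolding set_integrable_def
    by (intro Bochner_Integration.integrable_add integrable_mult_right) auto
  have nn: "AE t in lborel. 0 \<le> indicator {0..h} t * (a + b * t)"
    using nonneg by (auto simp: indicator_def)
  show ?int
  proof -
    have "integrable (distr (density lborel (\<lambda>x. ennreal (indicator P x))) borel d) ?f"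
      unfolding D by (subst integrable_density) (use nn int in simp_all)
    then have "integrable (density lborel (\<lambda>x. ennreal (indicator P x))) (\<lambda>x. ?f (d x))"
      by (subst (asm) integrable_distr_eq) auto
    then show ?thesis
      unfolding set_integrable_def by (subst (asm) integrable_density) auto
  qed
  have "(LINT x:P|lborel. ?f (d x)) = (\<integral>x. ?f (d x) \<partial>density lborel (\<lambda>x. ennreal (indicator P x)))"
    unfolding set_lebesgue_integral_def by (subst integral_density) auto
  also have "\<dots> = (\<integral>t. ?f t \<partial>distr (density lborel (\<lambda>x. ennreal (indicator P x))) borel d)"
    by (subst integral_distr) auto
  also have "\<dots> = (\<integral>t. (indicator {0..h} t * (a + b * t)) *\<^sub>R ?f t \<partial>lborel)"
    unfolding D by (subst integral_density) (use nn in auto)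
  also have "\<dots> = of_real a * (of_real h powr (s - 1) / (s - 1)) + of_real b * (of_real h powr s / s)"
    unfolding eq using I s h unfolding set_integrable_def set_lebesgue_integral_def
    by (subst Bochner_Integration.integral_add)
      (auto intro!: integrable_mult_right simp del: mult_scaleR_right)
  finally show ?eq .
qed

text \<open>At a real exponent the complex power of a positive distance is a real power, so the
  nonnegative integral is read off from the complex one.\<close>

lemma nn_distance_moment:
  fixes d :: "'a::euclidean_space \<Rightarrow> real" and \<sigma> :: real
  assumes [measurable]: "P \<in> sets borel" "d \<in> borel_measurable borel"
    and h: "0 < h" and d: "\<And>x. x \<in> P \<Longrightarrow> 0 < d x \<and> d x \<le> h"
    and nonneg: "\<And>t. 0 \<le> t \<Longrightarrow> t \<le> h \<Longrightarrow> 0 \<le> a + b * t"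
    and level: "\<And>t. 0 \<le> t \<Longrightarrow> t \<le> h \<Longrightarrow>
      emeasure lborel {x \<in> P. t < d x} = ennreal (a * (h - t) + b * (h\<^sup>2 - t\<^sup>2) / 2)"
    and \<sigma>: "\<sigma> > 1"
  shows "(\<integral>\<^sup>+x\<in>P. ennreal (d x powr (\<sigma> - 2)) \<partial>lborel)
         = ennreal (a * (h powr (\<sigma> - 1) / (\<sigma> - 1)) + b * (h powr \<sigma> / \<sigma>))" (is "?I = ennreal ?r")
proof -
  note M = distance_moment[OF assms(1-3) d nonneg level, of "of_real \<sigma>"]
  have eq: "indicator P x *\<^sub>R of_real (d x) powr (of_real \<sigma> - 2 :: complex)
      = of_real (indicator P x * d x powr (\<sigma> - 2))" for x
    using d[of x] powr_of_real[of "d x" "\<sigma> - 2"] by (auto simp: indicator_def scaleR_conv_of_real)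
  have i: "integrable lborel (\<lambda>x. indicator P x * d x powr (\<sigma> - 2))"
    using M(1) \<sigma> unfolding set_integrable_def eq by (simp only: complex_of_real_integrable_eq) simp
  have "complex_of_real (\<integral>x. indicator P x * d x powr (\<sigma> - 2) \<partial>lborel) = of_real ?r"
    using M(2) \<sigma> h powr_of_real[of h "\<sigma> - 1"] powr_of_real[of h "\<sigma>"]
    unfolding set_lebesgue_integral_def eq integral_complex_of_real by simp
  then have r: "(\<integral>x. indicator P x * d x powr (\<sigma> - 2) \<partial>lborel) = ?r"
    by (simp only: of_real_eq_iff)
  have "?I = (\<integral>\<^sup>+x. ennreal (indicator P x * d x powr (\<sigma> - 2)) \<partial>lborel)"
    by (intro nn_integral_cong) (auto simp: indicator_def)
  also have "\<dots> = ennreal ?r"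
    using i r by (subst nn_integral_eq_integral) auto
  finally show ?thesis .
qed

section \<open>Geometry of the carpet\<close>

text \<open>Generations are counted from 0: the hole in the square of side \<open>1 / 3 ^ n\<close>
  with corner \<open>c\<close> has side \<open>1 / 3 ^ Suc n\<close> and disappears in step
  \<open>Suc n\<close>.\<close>

definition carpet_hole :: "nat \<Rightarrow> real \<times> real \<Rightarrow> (real \<times> real) set" where
  "carpet_hole n c = box (fst c + 1 / 3 ^ Suc n, snd c + 1 / 3 ^ Suc n)
                         (fst c + 2 / 3 ^ Suc n, snd c + 2 / 3 ^ Suc n)"

definition carpet_holes :: "nat \<Rightarrow> (real \<times> real) set" where
  "carpet_holes n = (\<Union>c\<in>carpet_corners n. carpet_hole n c)"

text \<open>Half-open, so that cells of one level are pairwise disjoint and contain their lower left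
  corners, while the open holes still fit inside.\<close>

definition triadic_cell :: "nat \<Rightarrow> real \<times> real \<Rightarrow> (real \<times> real) set" where
  "triadic_cell n c = {fst c..<fst c + 1 / 3 ^ n} \<times> {snd c..<snd c + 1 / 3 ^ n}"

lemma mem_box_pair: "p \<in> box (a, b) (c, d) \<longleftrightarrow> a < fst p \<and> fst p < c \<and> b < snd p \<and> snd p < d"
  for a b c d :: real
  by (cases p) (auto simp: box_prod)

lemma mem_cbox_pair: "p \<in> cbox (a, b) (c, d) \<longleftrightarrow> a \<le> fst p \<and> fst p \<le> c \<and> b \<le> snd p \<and> snd p \<le> d"
  for a b c d :: real
  by (cases p) auto

lemma emeasure_lborel_square:
  fixes a b r :: real
  assumes "r \<ge> 0"
  shows "emeasure lborel (box (a, b) (a + r, b + r)) = ennreal (r\<^sup>2)"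
proof -
  have "emeasure lborel (box (a, b) (a + r, b + r)) = emeasure (lborel \<Otimes>\<^sub>M lborel) ({a<..<a + r} \<times> {b<..<b + r})"
    by (simp add: lborel_prod box_prod)
  also have "\<dots> = ennreal r * ennreal r"
    using assms by (subst lborel.emeasure_pair_measure_Times) auto
  finally show ?thesis
    using assms by (simp add: ennreal_mult power2_eq_square)
qed

lemma emeasure_lborel_square_closed:
  fixes a b r :: real
  assumes "r \<ge> 0"
  shows "emeasure lborel (cbox (a, b) (a + r, b + r)) = ennreal (r\<^sup>2)"
proof -
  have "emeasure lborel (cbox (a, b) (a + r, b + r)) = emeasure (lborel \<Otimes>\<^sub>M lborel) ({a..a + r} \<times> {b..b + r})"
    by (simp add: lborel_prod cbox_Pair_eq)
  also have "\<dots> = ennreal r * ennreal r"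
    using assms by (subst lborel.emeasure_pair_measure_Times) auto
  finally show ?thesis
    using assms by (simp add: ennreal_mult power2_eq_square)
qed

section \<open>Triadic cells: uniqueness, nesting and the number of corners\<close>

lemma carpet_corners_triadic:
  assumes "c \<in> carpet_corners n"
  obtains i j :: int where "c = (of_int i / 3 ^ n, of_int j / 3 ^ n)"
proof -
  have "\<exists>i j :: int. c = (of_int i / 3 ^ n, of_int j / 3 ^ n)"
    using assms
  proof (induction n arbitrary: c)
    case 0
    show ?case
      using 0 by (intro exI[of _ 0]) auto
  next
    case (Suc n)
    then obtain x y i j where c: "c = (x + real i / 3 ^ Suc n, y + real j / 3 ^ Suc n)"
      "(x, y) \<in> carpet_corners n" by auto
    then obtain k l :: int where "x = of_int k / 3 ^ n" "y = of_int l / 3 ^ n"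
      using Suc.IH by blast
    with c show ?case
      by (intro exI[of _ "3 * k + int i"] exI[of _ "3 * l + int j"]) (simp add: field_simps)
  qed
  then show ?thesis using that by blast
qed

text \<open>The integer coordinates of the corner are the floors of 3^n times the coordinates of the
  point.\<close>

lemma triadic_cell_unique:
  assumes "c \<in> carpet_corners n" "c' \<in> carpet_corners n" "p \<in> triadic_cell n c" "p \<in> triadic_cell n c'"
  shows "c = c'"
proof -
  obtain i j where c: "c = (of_int i / 3 ^ n, of_int j / 3 ^ n)"
    using assms(1) by (rule carpet_corners_triadic)
  obtain i' j' where c': "c' = (of_int i' / 3 ^ n, of_int j' / 3 ^ n)"
    using assms(2) by (rule carpet_corners_triadic)
  have "i = \<lfloor>3 ^ n * fst p\<rfloor>" "i' = \<lfloor>3 ^ n * fst p\<rfloor>" "j = \<lfloor>3 ^ n * snd p\<rfloor>" "j' = \<lfloor>3 ^ n * snd p\<rfloor>"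
    using assms(3,4) unfolding c c'
    by (auto simp: triadic_cell_def field_simps intro!: floor_unique[symmetric])
  then show ?thesis by (simp add: c c')
qed

lemma triadic_subcell:
  assumes "i \<le> 2" "j \<le> 2"
    "p \<in> triadic_cell (Suc n) (x + real i / 3 ^ Suc n, y + real j / 3 ^ Suc n)"
  shows "p \<in> triadic_cell n (x, y)"
proof -
  have "real i / 3 ^ Suc n + 1 / 3 ^ Suc n \<le> 1 / 3 ^ n" "real j / 3 ^ Suc n + 1 / 3 ^ Suc n \<le> 1 / 3 ^ n"
    using assms(1,2) by (auto simp: field_simps)
  moreover have "0 \<le> real i / 3 ^ Suc n" "0 \<le> real j / 3 ^ Suc n"
    by auto
  moreover have "x + real i / 3 ^ Suc n \<le> fst p" "fst p < x + real i / 3 ^ Suc n + 1 / 3 ^ Suc n"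
    "y + real j / 3 ^ Suc n \<le> snd p" "snd p < y + real j / 3 ^ Suc n + 1 / 3 ^ Suc n"
    using assms(3) by (auto simp: triadic_cell_def simp del: power_Suc)
  ultimately have "x \<le> fst p" "fst p < x + 1 / 3 ^ n" "y \<le> snd p" "snd p < y + 1 / 3 ^ n"
    by linarith+
  then show ?thesis
    by (auto simp: triadic_cell_def mem_Times_iff)
qed

lemma triadic_subcell_unique:
  assumes "p \<in> triadic_cell (Suc n) (x + real i / 3 ^ Suc n, y + real j / 3 ^ Suc n)"
    "p \<in> triadic_cell (Suc n) (x + real i' / 3 ^ Suc n, y + real j' / 3 ^ Suc n)"
  shows "i = i'" "j = j'"
proof -
  have "int i = \<lfloor>3 ^ Suc n * (fst p - x)\<rfloor>" "int i' = \<lfloor>3 ^ Suc n * (fst p - x)\<rfloor>"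
    "int j = \<lfloor>3 ^ Suc n * (snd p - y)\<rfloor>" "int j' = \<lfloor>3 ^ Suc n * (snd p - y)\<rfloor>"
    using assms by (auto simp: triadic_cell_def field_simps intro!: floor_unique[symmetric])
  then show "i = i'" "j = j'" by linarith+
qed

text \<open>The index (1, 1) skipped by the recursion of \<open>carpet_corners\<close> is that of
  the hole. This reduces disjointness from holes to uniqueness of cells.\<close>

lemma carpet_hole_subset_middle_cell:
  "carpet_hole n (x, y) \<subseteq> triadic_cell (Suc n) (x + real 1 / 3 ^ Suc n, y + real 1 / 3 ^ Suc n)"
  by (auto simp: carpet_hole_def triadic_cell_def mem_box_pair field_simps)

lemma carpet_hole_subset_cell: "carpet_hole n c \<subseteq> triadic_cell n c"
  using carpet_hole_subset_middle_cell[of n "fst c" "snd c"] triadic_subcell[of 1 1 _ n "fst c" "snd c"]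
  by auto

lemma triadic_cell_subset_square:
  assumes "c \<in> carpet_corners n"
  shows "triadic_cell n c \<subseteq> {0..<1} \<times> {0..<1}"
  using assms
proof (induction n arbitrary: c)
  case 0
  then show ?case by (auto simp: triadic_cell_def)
next
  case (Suc n)
  then obtain x y i j where c: "c = (x + real i / 3 ^ Suc n, y + real j / 3 ^ Suc n)"
      "(x, y) \<in> carpet_corners n" "i \<le> 2" "j \<le> 2" by auto
  then have "triadic_cell (Suc n) c \<subseteq> triadic_cell n (x, y)"
    using triadic_subcell by blast
  also have "\<dots> \<subseteq> {0..<1} \<times> {0..<1}"
    using c Suc.IH by blast
  finally show ?case .
qed

text \<open>A cell lies in its parent cell. Among the holes of the parent's generation only the
  parent's own can meet it, and that one sits in the middle child, which a surviving cell never is.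
  Holes of earlier generations already miss the parent by induction.\<close>

lemma triadic_cell_avoids_larger_holes:
  assumes "c \<in> carpet_corners n" "m < n"
  shows "triadic_cell n c \<inter> carpet_holes m = {}"
  using assms
proof (induction n arbitrary: c)
  case (Suc n)
  then obtain x y i j where c: "c = (x + real i / 3 ^ Suc n, y + real j / 3 ^ Suc n)"
      "(x, y) \<in> carpet_corners n" "i \<le> 2" "j \<le> 2" "(i, j) \<noteq> (1, 1)" by auto
  then have sub: "triadic_cell (Suc n) c \<subseteq> triadic_cell n (x, y)"
    using triadic_subcell by blast
  show ?case
  proof (cases "m = n")
    case True
    have False if p: "p \<in> triadic_cell (Suc n) c" and c': "c' \<in> carpet_corners n" "p \<in> carpet_hole n c'" for p c'
    proof -
      have "c' = (x, y)"
        using c c' p sub carpet_hole_subset_cell triadic_cell_unique by blast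
      then have "p \<in> triadic_cell (Suc n) (x + real 1 / 3 ^ Suc n, y + real 1 / 3 ^ Suc n)"
        using c'(2) carpet_hole_subset_middle_cell by blast
      from triadic_subcell_unique[OF p[unfolded c(1)] this] c(5) show False
        by simp
    qed
    then show ?thesis
      by (auto simp: carpet_holes_def True)
  next
    case False
    then show ?thesis
      using sub c Suc by (metis disjoint_iff less_SucE subsetD)
  qed
qed auto

text \<open>The hole of the later generation lies in its own cell, which avoids all holes of earlier
  generations.\<close>

lemma disjoint_carpet_holes:
  assumes "m \<noteq> n"
  shows "carpet_holes m \<inter> carpet_holes n = {}"
proof -
  have "carpet_holes m \<inter> carpet_holes n = {}" if "m < n" for m n
    using triadic_cell_avoids_larger_holes[OF _ that] carpet_hole_subset_cell
    unfolding carpet_holes_def[of n] by blast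
  then show ?thesis
    using assms by (metis Int_commute linorder_neqE_nat)
qed

lemma carpet_hole_unique:
  assumes "c \<in> carpet_corners n" "c' \<in> carpet_corners n" "p \<in> carpet_hole n c" "p \<in> carpet_hole n c'"
  shows "c = c'"
  using assms triadic_cell_unique carpet_hole_subset_cell by blast

text \<open>Each corner comes from exactly one pair of a parent corner and one of the 9 - 1 = 8
  admissible indices, so each step multiplies the count by 8.\<close>

lemma finite_carpet_corners: "finite (carpet_corners n)"
  and card_carpet_corners: "card (carpet_corners n) = 8 ^ n"
proof (induction n)
  case (Suc n)
  define D where "D = {..2::nat} \<times> {..2::nat} - {(1, 1)}"
  define f :: "(real \<times> real) \<times> nat \<times> nat \<Rightarrow> real \<times> real"
    where "f = (\<lambda>((x, y), (i, j)). (x + real i / 3 ^ Suc n, y + real j / 3 ^ Suc n))"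
  have im: "carpet_corners (Suc n) = f ` (carpet_corners n \<times> D)"
  proof (rule set_eqI)
    fix p
    have "p \<in> carpet_corners (Suc n) \<longleftrightarrow>
        (\<exists>x y i j. p = f ((x, y), (i, j)) \<and> (x, y) \<in> carpet_corners n \<and> (i, j) \<in> D)"
      by (simp add: f_def D_def del: power_Suc)
    also have "\<dots> \<longleftrightarrow> p \<in> f ` (carpet_corners n \<times> D)"
      unfolding image_iff Bex_def mem_Times_iff split_paired_Ex fst_conv snd_conv by blast
    finally show "p \<in> carpet_corners (Suc n) \<longleftrightarrow> p \<in> f ` (carpet_corners n \<times> D)" .
  qed
  have "inj_on f (carpet_corners n \<times> D)"
  proof (rule inj_onI)
    fix u v
    assume uv: "u \<in> carpet_corners n \<times> D" "v \<in> carpet_corners n \<times> D" "f u = f v"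
    obtain x y i j x' y' i' j' where u: "u = ((x, y), i, j)" and v: "v = ((x', y'), i', j')"
      by (metis surj_pair)
    have mem: "(x, y) \<in> carpet_corners n" "(x', y') \<in> carpet_corners n" "(i, j) \<in> D" "(i', j') \<in> D"
      and eq: "f ((x, y), i, j) = f ((x', y'), i', j')"
      using uv u v by auto
    \<comment> \<open>The common corner itself is the witness: lying in both child cells, it forces
      equal parents and then equal indices.\<close>
    define p where "p = f ((x, y), i, j)"
    have p: "p \<in> triadic_cell (Suc n) (x + real i / 3 ^ Suc n, y + real j / 3 ^ Suc n)"
      "p \<in> triadic_cell (Suc n) (x' + real i' / 3 ^ Suc n, y' + real j' / 3 ^ Suc n)"
      using eq unfolding p_def f_def by (auto simp: triadic_cell_def)
    have "p \<in> triadic_cell n (x, y)" "p \<in> triadic_cell n (x', y')"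
      using mem by (intro triadic_subcell[OF _ _ p(1)] triadic_subcell[OF _ _ p(2)]; simp add: D_def)+
    then have xy: "x' = x" "y' = y"
      using triadic_cell_unique[OF mem(1,2), of p] by auto
    then show "u = v"
      using triadic_subcell_unique[OF p[unfolded xy]] u v by simp
  qed
  then have "card (carpet_corners (Suc n)) = card (carpet_corners n) * card D"
    by (simp only: im card_image card_cartesian_product)
  also have "card D = 8"
    by (simp add: D_def card_Diff_singleton)
  finally show "card (carpet_corners (Suc n)) = 8 ^ Suc n"
    using Suc by simp
  show "finite (carpet_corners (Suc n))"
    unfolding im using Suc by (simp add: D_def)
qed auto

section \<open>The carpet as a closed set that contains the boundaries of the square and of all
  holes\<close>

lemma open_carpet_holes: "open (carpet_holes n)"
  by (auto simp: carpet_holes_def carpet_hole_def)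

lemma sierpinski_carpet_eq: "sierpinski_carpet = cbox (0, 0) (1, 1) - (\<Union>n. carpet_holes n)"
proof -
  have "carpet_stage n = cbox (0, 0) (1, 1) - (\<Union>m<n. carpet_holes m)" for n
  proof (induction n)
    case (Suc n)
    then show ?case
      by (simp add: carpet_holes_def carpet_hole_def lessThan_Suc case_prod_beta del: power_Suc) blast
  qed auto
  then show ?thesis
    unfolding sierpinski_carpet_def by auto
qed

lemma closed_sierpinski_carpet: "closed sierpinski_carpet"
  unfolding sierpinski_carpet_eq by (intro closed_Diff closed_cbox open_UN ballI open_carpet_holes)

lemma closed_hole_subset_square:
  assumes "c \<in> carpet_corners n"
  shows "closure (carpet_hole n c) \<subseteq> cbox (0, 0) (1, 1)"
proof -
  have "carpet_hole n c \<subseteq> {0..<1} \<times> {0..<1}"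
    using carpet_hole_subset_cell triadic_cell_subset_square[OF assms] by (rule order_trans)
  also have "\<dots> \<subseteq> cbox (0, 0) (1, 1)"
    by auto
  finally show ?thesis
    by (intro closure_minimal closed_cbox)
qed

text \<open>An open subset of the closed square lies in its interior. Hence no boundary point of the
  unit square is ever deleted.\<close>

lemma carpet_holes_subset_open_square: "carpet_holes n \<subseteq> box (0, 0) (1, 1)"
proof -
  have "carpet_holes n \<subseteq> cbox (0, 0) (1, 1)"
    unfolding carpet_holes_def by (intro UN_least order_trans[OF closure_subset closed_hole_subset_square])
  then have "carpet_holes n \<subseteq> interior (cbox (0, 0) (1, 1))"
    by (intro interior_maximal open_carpet_holes)
  then show ?thesis by simp
qed

lemma square_boundary_subset_carpet: "cbox (0, 0) (1, 1) - box (0, 0) (1, 1) \<subseteq> sierpinski_carpet"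
  using carpet_holes_subset_open_square by (auto simp: sierpinski_carpet_eq)

text \<open>An open deleted square that contained a boundary point of another one would meet it.\<close>

lemma hole_boundary_subset_carpet:
  assumes c: "c \<in> carpet_corners n"
  shows "closure (carpet_hole n c) - carpet_hole n c \<subseteq> sierpinski_carpet"
proof
  fix p assume p: "p \<in> closure (carpet_hole n c) - carpet_hole n c"
  have False if "p \<in> carpet_holes m" for m
  proof -
    obtain c' where c': "c' \<in> carpet_corners m" "p \<in> carpet_hole m c'"
      using \<open>p \<in> carpet_holes m\<close> by (auto simp: carpet_holes_def)
    moreover have "open (carpet_hole m c')"
      by (auto simp: carpet_hole_def)
    ultimately obtain q where q: "q \<in> carpet_hole n c" "q \<in> carpet_hole m c'"
      using p open_Int_closure_eq_empty[of "carpet_hole m c'" "carpet_hole n c"] by blast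
    then have "m = n"
      using c c' disjoint_carpet_holes[of m n] by (auto simp: carpet_holes_def)
    then show False
      using q c c' p carpet_hole_unique by blast
  qed
  then show "p \<in> sierpinski_carpet"
    using p closed_hole_subset_square[OF c] by (auto simp: sierpinski_carpet_eq)
qed

section \<open>Explicit distances inside a hole and outside the unit square\<close>

text \<open>A point of \<open>A\<close> is outside the square, hence at least this far from
  \<open>p\<close> in the maximum norm, which is at most the Euclidean norm. Equality holds at the
  foot of the perpendicular on the nearest edge, a point of \<open>A\<close> by the boundary
  assumption.\<close>

lemma infdist_in_square_hole:
  fixes A :: "(real \<times> real) set"
  assumes r: "r > 0" and S: "S = box (a, b) (a + 2 * r, b + 2 * r)" and p: "p \<in> S"
    and disj: "S \<inter> A = {}" and bd: "closure S - S \<subseteq> A"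
  shows "infdist p A = r - max \<bar>fst p - (a + r)\<bar> \<bar>snd p - (b + r)\<bar>"
proof -
  have cl: "closure S = cbox (a, b) (a + 2 * r, b + 2 * r)"
    using p unfolding S by (intro closure_box) auto
  let ?m = "max \<bar>fst p - (a + r)\<bar> \<bar>snd p - (b + r)\<bar>"
  have ex: "\<exists>q\<in>A. dist p q = r - ?m"
  proof (cases "\<bar>snd p - (b + r)\<bar> \<le> \<bar>fst p - (a + r)\<bar>")
    case True
    \<comment> \<open>The coordinate that deviates most from the centre decides the nearest edge;
      here it is a vertical one, on the side of \<open>p\<close>.\<close>
    define q where "q = (if fst p \<ge> a + r then a + 2 * r else a, snd p)"
    have "q \<in> closure S"
      using p r unfolding cl by (auto simp: q_def S mem_box_pair mem_cbox_pair)
    moreover have "q \<notin> S"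
      using r by (auto simp: q_def S mem_box_pair)
    moreover have "dist p q = r - ?m"
      using p r True unfolding S by (cases p) (auto simp: q_def dist_Pair_Pair dist_real_def mem_box_pair)
    ultimately show ?thesis using bd by (metis Diff_iff subsetD)
  next
    case False
    define q where "q = (fst p, if snd p \<ge> b + r then b + 2 * r else b)"
    have "q \<in> closure S"
      using p r unfolding cl by (auto simp: q_def S mem_box_pair mem_cbox_pair)
    moreover have "q \<notin> S"
      using r by (auto simp: q_def S mem_box_pair)
    moreover have "dist p q = r - ?m"
      using p r False unfolding S by (cases p) (auto simp: q_def dist_Pair_Pair dist_real_def mem_box_pair)
    ultimately show ?thesis using bd by (metis Diff_iff subsetD)
  qed
  have "r - ?m \<le> dist p q" if "q \<in> A" for q
  proof -
    have "q \<notin> S" using that disj by auto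
    then have "r - ?m \<le> max \<bar>fst p - fst q\<bar> \<bar>snd p - snd q\<bar>"
      unfolding S mem_box_pair by linarith
    also have "\<dots> \<le> dist p q"
      using dist_fst_le[of p q] dist_snd_le[of p q] by (simp add: dist_real_def)
    finally show ?thesis .
  qed
  then have "r - ?m \<le> infdist p A"
    using ex by (subst infdist_notempty) (auto intro!: cINF_greatest)
  moreover have "infdist p A \<le> r - ?m"
    using ex infdist_le by metis
  ultimately show ?thesis by simp
qed

text \<open>The square is written as lower corner plus side so that
  \<open>emeasure_lborel_square\<close> applies. For t \<ge> r both sides are empty.\<close>

lemma infdist_in_square_hole_greater:
  fixes A :: "(real \<times> real) set"
  assumes "r > 0" "S = box (a, b) (a + 2 * r, b + 2 * r)" "S \<inter> A = {}" "closure S - S \<subseteq> A" "t \<ge> 0"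
  shows "{p \<in> S. t < infdist p A} = box (a + t, b + t) (a + t + 2 * (r - t), b + t + 2 * (r - t))"
  using assms(5) infdist_in_square_hole[OF assms(1,2) _ assms(3,4)]
  by (auto simp: assms(2) mem_box_pair abs_less_iff)

text \<open>This is the distance of \<open>x\<close> from the interval [0, 1].\<close>

definition unit_interval_excess :: "real \<Rightarrow> real" where
  "unit_interval_excess x = max 0 (max (- x) (x - 1))"

text \<open>The nearest point of the square is obtained by clamping both coordinates to [0, 1]. For
  \<open>p\<close> outside the square it is a boundary point, hence belongs to
  \<open>A\<close>.\<close>

lemma infdist_outside_unit_square:
  fixes A :: "(real \<times> real) set"
  assumes p: "p \<notin> cbox (0, 0) (1, 1)"
    and sub: "A \<subseteq> cbox (0, 0) (1, 1)" and bd: "cbox (0, 0) (1, 1) - box (0, 0) (1, 1) \<subseteq> A"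
  shows "infdist p A = norm (unit_interval_excess (fst p), unit_interval_excess (snd p))"
proof -
  let ?u = unit_interval_excess
  have le: "norm (?u (fst p), ?u (snd p)) \<le> dist p q" if "q \<in> A" for q
  proof -
    have "?u (fst p) \<le> \<bar>fst p - fst q\<bar>" "?u (snd p) \<le> \<bar>snd p - snd q\<bar>"
      using subsetD[OF sub that] by (auto simp: unit_interval_excess_def mem_cbox_pair)
    moreover have "0 \<le> ?u (fst p)" "0 \<le> ?u (snd p)"
      by (auto simp: unit_interval_excess_def)
    ultimately show ?thesis
      unfolding dist_prod_def norm_Pair dist_real_def real_norm_def
      by (intro real_sqrt_le_mono add_mono power_mono) auto
  qed
  define q where "q = (max 0 (min 1 (fst p)), max 0 (min 1 (snd p)))"
  have q: "q \<in> A"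
    using p bd by (intro subsetD[OF bd]) (auto simp: q_def mem_cbox_pair mem_box_pair)
  have "\<bar>fst p - fst q\<bar> = ?u (fst p)" "\<bar>snd p - snd q\<bar> = ?u (snd p)"
    by (auto simp: q_def unit_interval_excess_def)
  then have "dist p q = norm (?u (fst p), ?u (snd p))"
    by (simp add: dist_prod_def norm_Pair dist_real_def)
  with q have "infdist p A \<le> norm (?u (fst p), ?u (snd p))"
    using infdist_le by metis
  moreover have "norm (?u (fst p), ?u (snd p)) \<le> infdist p A"
    using q le by (subst infdist_notempty) (auto intro!: cINF_greatest)
  ultimately show ?thesis by simp
qed

section \<open>Areas of the level sets of the distance\<close>

lemma measurable_unit_interval_excess [measurable]: "unit_interval_excess \<in> borel_measurable borel"
  unfolding unit_interval_excess_def by measurable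

text \<open>The excess pushes Lebesgue measure to \<open>\<delta>\<^sub>0\<close> plus the law of \<open>\<bar>x\<bar>\<close>. Hence, by Fubini, areas outside the
  unit square split into integrals over lines and over the whole plane.\<close>

lemma nn_integral_unit_interval_excess:
  assumes [measurable]: "g \<in> borel_measurable borel"
  shows "(\<integral>\<^sup>+x. g (unit_interval_excess x) \<partial>lborel) = g 0 + (\<integral>\<^sup>+x. g \<bar>x\<bar> \<partial>lborel)"
proof -
  have "(\<integral>\<^sup>+x. g (unit_interval_excess x) \<partial>lborel)
      = (\<integral>\<^sup>+x. g 0 * indicator {0..1} x + (g (- x) * indicator {..<0} x + g (x - 1) * indicator {1<..} x) \<partial>lborel)"
    by (intro nn_integral_cong) (auto simp: unit_interval_excess_def indicator_def)
  also have "\<dots> = g 0 + ((\<integral>\<^sup>+x. g (- x) * indicator {..<0} x \<partial>lborel) + (\<integral>\<^sup>+x. g (x - 1) * indicator {1<..} x \<partial>lborel))"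
    by (subst nn_integral_add, measurable)+ (simp add: nn_integral_cmult_indicator)
  also have "(\<integral>\<^sup>+x. g (x - 1) * indicator {1<..} x \<partial>lborel) = (\<integral>\<^sup>+x. g x * indicator {0<..} x \<partial>lborel)"
    by (subst nn_integral_real_affine[of _ 1 1]) (auto intro!: nn_integral_cong simp: indicator_def)
  also have "(\<integral>\<^sup>+x. g (- x) * indicator {..<0} x \<partial>lborel) + (\<integral>\<^sup>+x. g x * indicator {0<..} x \<partial>lborel)
      = (\<integral>\<^sup>+x. g (- x) * indicator {..<0} x + g x * indicator {0<..} x \<partial>lborel)"
    by (subst nn_integral_add) auto
  also have "\<dots> = (\<integral>\<^sup>+x. g \<bar>x\<bar> \<partial>lborel)"
    using AE_lborel_singleton[of 0] by (intro nn_integral_cong_AE) (auto simp: indicator_def)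
  finally show ?thesis .
qed

text \<open>The four terms belong to the square itself, the strips left and right of it, the strips
  below and above, and the four corner quadrants, which reassemble to a full plane.\<close>

lemma nn_integral_unit_square_excess:
  fixes F :: "real \<times> real \<Rightarrow> ennreal"
  assumes [measurable]: "F \<in> borel_measurable borel"
  shows "(\<integral>\<^sup>+p. F (unit_interval_excess (fst p), unit_interval_excess (snd p)) \<partial>lborel)
       = F (0, 0) + (\<integral>\<^sup>+x. F (\<bar>x\<bar>, 0) \<partial>lborel) + (\<integral>\<^sup>+y. F (0, \<bar>y\<bar>) \<partial>lborel)
         + (\<integral>\<^sup>+p. F (\<bar>fst p\<bar>, \<bar>snd p\<bar>) \<partial>lborel)"
proof -
  let ?u = unit_interval_excess
  have [measurable]: "(\<lambda>p. F (?u (fst p), ?u (snd p))) \<in> borel_measurable (lborel \<Otimes>\<^sub>M lborel)"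
    "(\<lambda>p. F (\<bar>fst p\<bar>, \<bar>snd p\<bar>)) \<in> borel_measurable (lborel \<Otimes>\<^sub>M lborel)"
    by measurable
  have "(\<integral>\<^sup>+p. F (?u (fst p), ?u (snd p)) \<partial>lborel) = (\<integral>\<^sup>+x. \<integral>\<^sup>+y. F (?u x, ?u y) \<partial>lborel \<partial>lborel)"
    by (simp add: lborel_prod[symmetric] lborel.nn_integral_fst[symmetric])
  also have "\<dots> = (\<integral>\<^sup>+x. F (?u x, 0) + (\<integral>\<^sup>+y. F (?u x, \<bar>y\<bar>) \<partial>lborel) \<partial>lborel)"
    by (intro nn_integral_cong nn_integral_unit_interval_excess) measurable
  also have "\<dots> = (F (0, 0) + (\<integral>\<^sup>+y. F (0, \<bar>y\<bar>) \<partial>lborel))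
      + (\<integral>\<^sup>+x. F (\<bar>x\<bar>, 0) + (\<integral>\<^sup>+y. F (\<bar>x\<bar>, \<bar>y\<bar>) \<partial>lborel) \<partial>lborel)"
    by (intro nn_integral_unit_interval_excess[of "\<lambda>u. F (u, 0) + (\<integral>\<^sup>+y. F (u, \<bar>y\<bar>) \<partial>lborel)"]) measurable
  also have "(\<integral>\<^sup>+x. F (\<bar>x\<bar>, 0) + (\<integral>\<^sup>+y. F (\<bar>x\<bar>, \<bar>y\<bar>) \<partial>lborel) \<partial>lborel)
      = (\<integral>\<^sup>+x. F (\<bar>x\<bar>, 0) \<partial>lborel) + (\<integral>\<^sup>+x. \<integral>\<^sup>+y. F (\<bar>x\<bar>, \<bar>y\<bar>) \<partial>lborel \<partial>lborel)"
    by (intro nn_integral_add) measurable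
  also have "(\<integral>\<^sup>+x. \<integral>\<^sup>+y. F (\<bar>x\<bar>, \<bar>y\<bar>) \<partial>lborel \<partial>lborel) = (\<integral>\<^sup>+p. F (\<bar>fst p\<bar>, \<bar>snd p\<bar>) \<partial>lborel)"
    by (simp add: lborel_prod[symmetric] lborel.nn_integral_fst[symmetric])
  finally show ?thesis
    by (simp add: ac_simps)
qed

text \<open>For t < h this is an open disc minus a closed one contained in it; for t = h the
  containment fails, but the set is empty.\<close>

lemma emeasure_annulus:
  assumes "0 \<le> t" "t \<le> h"
  shows "emeasure lborel {p :: real \<times> real. t < norm p \<and> norm p < h} = ennreal (pi * (h\<^sup>2 - t\<^sup>2))"
proof (cases "t < h")
  case True
  have "{p :: real \<times> real. t < norm p \<and> norm p < h} = ball 0 h - cball 0 t"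
    by auto
  moreover have "emeasure lborel (ball 0 h - cball 0 t :: (real \<times> real) set)
      = emeasure lborel (ball 0 h :: (real \<times> real) set) - emeasure lborel (cball 0 t :: (real \<times> real) set)"
    using assms True by (intro emeasure_Diff) (auto simp: emeasure_cball)
  ultimately show ?thesis
    using assms by (simp add: emeasure_ball emeasure_cball unit_ball_vol_2 ennreal_minus right_diff_distrib power2_eq_square)
next
  case False
  then have empty: "{p :: real \<times> real. t < norm p \<and> norm p < h} = {}" and "t = h"
    using assms by auto
  then show ?thesis
    unfolding empty by simp
qed

lemma emeasure_abs_between:
  assumes "0 \<le> t" "t \<le> h"
  shows "emeasure lborel {x :: real. t < \<bar>x\<bar> \<and> \<bar>x\<bar> < h} = ennreal (2 * (h - t))"
proof -
  have "{x :: real. t < \<bar>x\<bar> \<and> \<bar>x\<bar> < h} = {t<..<h} \<union> {-h<..<-t}"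
    using assms by auto
  also have "emeasure lborel \<dots> = emeasure lborel {t<..<h} + emeasure lborel {-h<..<-t}"
    using assms by (intro plus_emeasure[symmetric]) auto
  finally show ?thesis
    using assms by (simp flip: ennreal_plus)
qed

text \<open>The two line integrals contribute 2 (h - t) each and the plane integral the area of an
  annulus; the square itself contributes 0 because t \<ge> 0. The factor
  \<open>2 * pi * _ / 2\<close> displays the coefficients a = 4 and b = 2 pi of the moment
  formula.\<close>

lemma emeasure_unit_square_annulus:
  assumes "0 \<le> t" "t \<le> h"
  shows "emeasure lborel {p. t < norm (unit_interval_excess (fst p), unit_interval_excess (snd p)) \<and>
                             norm (unit_interval_excess (fst p), unit_interval_excess (snd p)) < h}
       = ennreal (4 * (h - t) + 2 * pi * (h\<^sup>2 - t\<^sup>2) / 2)"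
proof -
  define R :: "(real \<times> real) set" where "R = {q. t < norm q \<and> norm q < h}"
  have [measurable]: "R \<in> sets borel"
    unfolding R_def by measurable
  define F :: "real \<times> real \<Rightarrow> ennreal" where "F = indicator R"
  have [measurable]: "F \<in> borel_measurable borel"
    unfolding F_def by measurable
  let ?u = unit_interval_excess
  have m: "(\<lambda>p. (?u (fst p), ?u (snd p))) \<in> borel \<rightarrow>\<^sub>M (borel :: (real \<times> real) measure)"
    unfolding borel_prod[symmetric] by measurable
  have meas: "{p. (?u (fst p), ?u (snd p)) \<in> R} \<in> sets borel"
    using measurable_sets[OF m, of R] by (simp add: vimage_def)
  have "emeasure lborel {p. (?u (fst p), ?u (snd p)) \<in> R} = (\<integral>\<^sup>+p. F (?u (fst p), ?u (snd p)) \<partial>lborel)"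
    using meas nn_integral_indicator[of "{p. (?u (fst p), ?u (snd p)) \<in> R}" lborel]
    by (simp add: F_def indicator_def)
  also have "\<dots> = F (0, 0) + (\<integral>\<^sup>+x. F (\<bar>x\<bar>, 0) \<partial>lborel) + (\<integral>\<^sup>+y. F (0, \<bar>y\<bar>) \<partial>lborel)
         + (\<integral>\<^sup>+p. F (\<bar>fst p\<bar>, \<bar>snd p\<bar>) \<partial>lborel)"
    by (rule nn_integral_unit_square_excess) measurable
  also have "F (0, 0) = 0"
    using assms by (simp add: F_def R_def)
  also have "(\<integral>\<^sup>+x. F (\<bar>x\<bar>, 0) \<partial>lborel) = (\<integral>\<^sup>+x. indicator {x. t < \<bar>x\<bar> \<and> \<bar>x\<bar> < h} x \<partial>lborel)"
    by (intro nn_integral_cong) (auto simp: F_def R_def indicator_def)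
  also have "\<dots> = ennreal (2 * (h - t))"
    using assms by (simp add: emeasure_abs_between)
  also have "(\<integral>\<^sup>+x. F (0, \<bar>x\<bar>) \<partial>lborel) = (\<integral>\<^sup>+x. indicator {x. t < \<bar>x\<bar> \<and> \<bar>x\<bar> < h} x \<partial>lborel)"
    by (intro nn_integral_cong) (auto simp: F_def R_def indicator_def)
  also have "\<dots> = ennreal (2 * (h - t))"
    using assms by (simp add: emeasure_abs_between)
  also have "(\<integral>\<^sup>+p. F (\<bar>fst p\<bar>, \<bar>snd p\<bar>) \<partial>lborel) = (\<integral>\<^sup>+p. indicator R p \<partial>lborel)"
    by (intro nn_integral_cong) (auto simp: F_def R_def indicator_def norm_Pair)
  also have "\<dots> = ennreal (pi * (h\<^sup>2 - t\<^sup>2))"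
    using assms by (simp add: R_def emeasure_annulus)
  also have "0 + ennreal (2 * (h - t)) + ennreal (2 * (h - t)) + ennreal (pi * (h\<^sup>2 - t\<^sup>2))
     = ennreal (4 * (h - t) + 2 * pi * (h\<^sup>2 - t\<^sup>2) / 2)"
    using assms by (simp add: power_mono flip: ennreal_plus)
  finally show ?thesis
    by (simp add: R_def)
qed

section \<open>Decomposition of the neighbourhood and the areas on its pieces\<close>

abbreviation "carpet_dist p \<equiv> infdist p sierpinski_carpet"

text \<open>The collar takes index 0 and shifts the holes by one, so that a single sequence of
  disjoint sets serves countable additivity.\<close>

definition carpet_piece :: "real \<Rightarrow> nat \<Rightarrow> (real \<times> real) set" where
  "carpet_piece \<delta> n = (case n of 0 \<Rightarrow> {p. p \<notin> cbox (0, 0) (1, 1) \<and> carpet_dist p < \<delta>} | Suc m \<Rightarrow> carpet_holes m)"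

text \<open>Since \<open>infdist\<close> to the empty set is 0 by convention, this is what lets a
  zero distance characterise membership in the closed carpet.\<close>

lemma sierpinski_carpet_nonempty: "sierpinski_carpet \<noteq> {}"
proof -
  have "(0, 0) \<in> sierpinski_carpet"
    by (rule subsetD[OF square_boundary_subset_carpet]) (auto simp: mem_box_pair)
  then show ?thesis by auto
qed

lemma carpet_dist_pos_iff: "0 < carpet_dist p \<longleftrightarrow> p \<notin> sierpinski_carpet"
  using infdist_nonneg[of p sierpinski_carpet]
    in_closed_iff_infdist_zero[OF closed_sierpinski_carpet sierpinski_carpet_nonempty, of p] by linarith

lemma borel_measurable_infdist_set [measurable]: "(\<lambda>p. infdist p A) \<in> borel_measurable borel"
  by (intro borel_measurable_continuous_onI continuous_intros)

lemma sets_carpet_piece [measurable]: "carpet_piece \<delta> n \<in> sets borel"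
proof (cases n)
  case 0
  have "{p. p \<notin> cbox (0, 0) (1, 1) \<and> carpet_dist p < \<delta>} = {p. carpet_dist p < \<delta>} - cbox (0, 0) (1, 1)"
    by auto
  also have "\<dots> \<in> sets borel" by measurable
  finally show ?thesis by (simp add: carpet_piece_def 0)
qed (auto simp: carpet_piece_def open_carpet_holes)

lemma disjoint_carpet_piece:
  assumes "m \<noteq> n"
  shows "carpet_piece \<delta> m \<inter> carpet_piece \<delta> n = {}"
proof -
  have "carpet_holes k \<subseteq> cbox (0, 0) (1, 1)" for k
    using carpet_holes_subset_open_square box_subset_cbox by blast
  then show ?thesis
    using assms disjoint_carpet_holes[of "m - 1" "n - 1"]
    by (cases m; cases n) (simp_all add: carpet_piece_def disjoint_iff subset_iff, blast)
qed

text \<open>Here \<open>r n\<close> is half the side of a hole, the distance of its centre from the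
  edges.\<close>

lemma carpet_hole_properties:
  defines "r n \<equiv> 1 / (2 * 3 ^ Suc n)"
  assumes c: "c \<in> carpet_corners n"
  shows "carpet_hole n c \<inter> sierpinski_carpet = {}"
    and "p \<in> carpet_hole n c \<Longrightarrow> carpet_dist p \<le> r n"
    and "t \<ge> 0 \<Longrightarrow> {p \<in> carpet_hole n c. t < carpet_dist p}
      = box (fst c + 1 / 3 ^ Suc n + t, snd c + 1 / 3 ^ Suc n + t)
            (fst c + 1 / 3 ^ Suc n + t + 2 * (r n - t), snd c + 1 / 3 ^ Suc n + t + 2 * (r n - t))"
proof -
  have r: "r n > 0"
    by (simp add: r_def)
  have box: "carpet_hole n c = box (fst c + 1 / 3 ^ Suc n, snd c + 1 / 3 ^ Suc n)
      (fst c + 1 / 3 ^ Suc n + 2 * r n, snd c + 1 / 3 ^ Suc n + 2 * r n)"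
    by (simp add: carpet_hole_def r_def field_simps)
  show disj: "carpet_hole n c \<inter> sierpinski_carpet = {}"
    using c by (auto simp: sierpinski_carpet_eq carpet_holes_def)
  show "carpet_dist p \<le> r n" if "p \<in> carpet_hole n c"
    using infdist_in_square_hole[OF r box that disj hole_boundary_subset_carpet[OF c]] by linarith
  show "{p \<in> carpet_hole n c. t < carpet_dist p}
      = box (fst c + 1 / 3 ^ Suc n + t, snd c + 1 / 3 ^ Suc n + t)
            (fst c + 1 / 3 ^ Suc n + t + 2 * (r n - t), snd c + 1 / 3 ^ Suc n + t + 2 * (r n - t))" if "t \<ge> 0"
    by (rule infdist_in_square_hole_greater[OF r box disj hole_boundary_subset_carpet[OF c] that])
qed

lemma emeasure_carpet_holes_greater:
  defines "r n \<equiv> 1 / (2 * 3 ^ Suc n)"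
  assumes t: "0 \<le> t" "t \<le> r n"
  shows "emeasure lborel {p \<in> carpet_holes n. t < carpet_dist p} = ennreal (8 ^ n * (2 * (r n - t))\<^sup>2)"
proof -
  note props = carpet_hole_properties[folded r_def]
  define B where "B c = {p \<in> carpet_hole n c. t < carpet_dist p}" for c
  have B: "emeasure lborel (B c) = ennreal ((2 * (r n - t))\<^sup>2)" "B c \<in> sets lborel" if "c \<in> carpet_corners n" for c
    unfolding B_def props(3)[OF that t(1)]
    by (rule emeasure_lborel_square) (use t in auto)
  have "{p \<in> carpet_holes n. t < carpet_dist p} = (\<Union>c\<in>carpet_corners n. B c)"
    by (auto simp: carpet_holes_def B_def)
  also have "emeasure lborel \<dots> = (\<Sum>c\<in>carpet_corners n. emeasure lborel (B c))"
  proof (rule sum_emeasure[symmetric])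
    show "disjoint_family_on B (carpet_corners n)"
      unfolding disjoint_family_on_def B_def using carpet_hole_unique by blast
  qed (use B finite_carpet_corners in auto)
  also have "\<dots> = (\<Sum>c\<in>carpet_corners n. ennreal ((2 * (r n - t))\<^sup>2))"
    by (intro sum.cong B refl)
  finally show ?thesis
    by (simp add: card_carpet_corners ennreal_mult' flip: ennreal_power ennreal_numeral)
qed

lemma carpet_holes_dist:
  assumes "p \<in> carpet_holes n"
  shows "0 < carpet_dist p" "carpet_dist p \<le> 1 / (2 * 3 ^ Suc n)"
proof -
  obtain c where c: "c \<in> carpet_corners n" "p \<in> carpet_hole n c"
    using assms by (auto simp: carpet_holes_def)
  show "0 < carpet_dist p"
    using carpet_hole_properties(1)[OF c(1)] c(2) by (auto simp: carpet_dist_pos_iff)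
  show "carpet_dist p \<le> 1 / (2 * 3 ^ Suc n)"
    using carpet_hole_properties(2)[OF c] .
qed

lemma null_sierpinski_carpet: "sierpinski_carpet \<in> null_sets lborel"
proof -
  have "(\<lambda>n. (8 / 9 :: real) ^ n) sums (1 / (1 - 8 / 9))"
    by (rule geometric_sums) simp
  moreover have "1 / 9 * (1 / (1 - 8 / 9)) = (1 :: real)"
    by simp
  ultimately have s: "(\<lambda>n. 1 / 9 * (8 / 9 :: real) ^ n) sums 1"
    by (metis sums_mult)
  have level: "emeasure lborel (carpet_holes n) = ennreal (1 / 9 * (8 / 9) ^ n)" for n
  proof -
    \<comment> \<open>The distance is positive on holes, so the level t = 0 gives their full area
      8^n / 9^(n+1).\<close>
    have "{p \<in> carpet_holes n. 0 < carpet_dist p} = carpet_holes n"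
      using carpet_holes_dist by auto
    then have "emeasure lborel (carpet_holes n) = ennreal (8 ^ n * (2 * (1 / (2 * 3 ^ Suc n) - 0))\<^sup>2)"
      using emeasure_carpet_holes_greater[of 0 n] by simp
    also have "8 ^ n * (2 * (1 / (2 * 3 ^ Suc n) - 0))\<^sup>2 = 1 / 9 * (8 / 9 :: real) ^ n"
    proof -
      have "(9 :: real) ^ n = 3 ^ n * 3 ^ n"
        by (simp flip: power_mult_distrib)
      then show ?thesis
        by (simp add: power_divide power2_eq_square)
    qed
    finally show ?thesis .
  qed
  have "range carpet_holes \<subseteq> sets lborel" "disjoint_family carpet_holes"
    using disjoint_carpet_holes open_carpet_holes by (auto simp: disjoint_family_on_def)
  then have "emeasure lborel (\<Union>n. carpet_holes n) = (\<Sum>n. ennreal (1 / 9 * (8 / 9) ^ n))"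
    unfolding level[symmetric] by (rule suminf_emeasure[symmetric])
  also have "\<dots> = 1"
    using s by (subst suminf_ennreal2) (auto simp: sums_iff)
  finally have holes: "emeasure lborel (\<Union>n. carpet_holes n) = 1" .
  have "emeasure lborel sierpinski_carpet
      = emeasure lborel (cbox (0, 0) (1, 1) :: (real \<times> real) set) - emeasure lborel (\<Union>n. carpet_holes n)"
    unfolding sierpinski_carpet_eq
  proof (rule emeasure_Diff)
    show "(\<Union>n. carpet_holes n) \<subseteq> cbox (0, 0) (1, 1)"
      by (intro UN_least order_trans[OF carpet_holes_subset_open_square box_subset_cbox])
    show "(\<Union>n. carpet_holes n) \<in> sets lborel"
      using open_carpet_holes by auto
    show "emeasure lborel (\<Union>n. carpet_holes n) \<noteq> \<infinity>"
      unfolding holes by simp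
  qed simp
  also have "\<dots> = 0"
    using emeasure_lborel_square_closed[of 1 0 0] holes by simp
  finally show ?thesis
    using closed_sierpinski_carpet by (auto simp: null_sets_def)
qed

text \<open>The number 1/6 is half the side of the central hole and bounds the distance on every
  hole, so for larger \<delta> all holes belong to the neighbourhood entirely.\<close>

lemma nbhd_carpet_eq:
  assumes "\<delta> > 1 / 6"
  shows "nbhd sierpinski_carpet \<delta> = sierpinski_carpet \<union> (\<Union>n. carpet_piece \<delta> n)"
proof -
  have "carpet_dist p < \<delta>" if "p \<in> carpet_holes n" for p n
  proof -
    have "carpet_dist p \<le> 1 / (2 * 3 ^ Suc n)"
      using carpet_holes_dist that by auto
    also have "\<dots> \<le> 1 / 6"
      by (simp add: field_simps)
    finally show ?thesis using assms by simp
  qed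
  then have holes: "(\<Union>n. carpet_holes n) \<subseteq> {p. carpet_dist p < \<delta>}"
    by auto
  have carpet: "sierpinski_carpet \<subseteq> {p. carpet_dist p < \<delta>}"
    using assms by auto
  have un: "(\<Union>n. carpet_piece \<delta> n) = {p. p \<notin> cbox (0, 0) (1, 1) \<and> carpet_dist p < \<delta>} \<union> (\<Union>n. carpet_holes n)"
    by (subst UNIV_nat_eq) (auto simp: carpet_piece_def)
  show ?thesis
    unfolding nbhd_def un using holes carpet by (auto simp: sierpinski_carpet_eq)
qed

lemma carpet_piece_outside_dist:
  assumes "p \<in> carpet_piece \<delta> 0"
  shows "0 < carpet_dist p \<and> carpet_dist p \<le> \<delta>"
proof -
  have "p \<notin> sierpinski_carpet" "carpet_dist p < \<delta>"
    using assms by (auto simp: carpet_piece_def sierpinski_carpet_eq)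
  then show ?thesis
    by (simp add: carpet_dist_pos_iff)
qed

lemma emeasure_carpet_piece_outside_greater:
  assumes "0 \<le> t" "t \<le> \<delta>"
  shows "emeasure lborel {p \<in> carpet_piece \<delta> 0. t < carpet_dist p}
      = ennreal (4 * (\<delta> - t) + 2 * pi * (\<delta>\<^sup>2 - t\<^sup>2) / 2)"
proof -
  have "sierpinski_carpet \<subseteq> cbox (0, 0) (1, 1)"
    by (auto simp: sierpinski_carpet_eq)
  then have d: "carpet_dist p = norm (unit_interval_excess (fst p), unit_interval_excess (snd p))"
    if "p \<notin> cbox (0, 0) (1, 1)" for p
    using square_boundary_subset_carpet that by (intro infdist_outside_unit_square) auto
  \<comment> \<open>The excess vanishes on the square, so the condition t < norm with t \<ge> 0
    already excludes it.\<close>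
  have "norm (unit_interval_excess (fst p), unit_interval_excess (snd p)) = 0" if "p \<in> cbox (0, 0) (1, 1)" for p
    using that by (auto simp: unit_interval_excess_def mem_cbox_pair norm_Pair)
  then have "{p \<in> carpet_piece \<delta> 0. t < carpet_dist p} =
      {p. t < norm (unit_interval_excess (fst p), unit_interval_excess (snd p)) \<and>
          norm (unit_interval_excess (fst p), unit_interval_excess (snd p)) < \<delta>}"
    using assms d by (intro Collect_eqI) (metis (mono_tags, lifting) carpet_piece_def mem_Collect_eq not_less old.nat.simps(4))
  then show ?thesis
    using emeasure_unit_square_annulus[OF assms] by simp
qed

section \<open>Poles of the closed form\<close>

text \<open>Multiplication by w - z leaves a removable singularity. The extended function is
  holomorphic with the nonzero value \<open>c\<close> at \<open>z\<close>, and dividing it by w - z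
  again gives a pole of order exactly one.\<close>

lemma simple_pole_of_limit:
  fixes f :: "complex \<Rightarrow> complex"
  assumes iso: "isolated_singularity_at f z"
    and lim: "((\<lambda>w. f w * (w - z)) \<longlongrightarrow> c) (at z)" and c: "c \<noteq> 0"
  shows "is_pole f z" and "zorder f z = -1" and "residue f z = c"
proof -
  obtain r where r: "r > 0" and holo: "f holomorphic_on (ball z r - {z})"
    using iso by (auto simp: isolated_singularity_at_def intro: analytic_imp_holomorphic)
  define g where "g = (\<lambda>w. if w = z then c else f w * (w - z))"
  have "(\<lambda>w. f w * (w - z)) holomorphic_on (ball z r - {z})"
    using holo by (intro holomorphic_intros)
  then have holo_g: "g holomorphic_on (ball z r - {z})"
    by (rule holomorphic_transform) (auto simp: g_def)
  have tend: "(g \<longlongrightarrow> g z) (at z)"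
    using lim by (rule Lim_transform_eventually[THEN tendsto_eq_rhs])
      (auto simp: g_def eventually_at_filter)
  have g: "g holomorphic_on ball z r"
  proof (rule no_isolated_singularity'[where K = "{z}"])
    show "(g \<longlongrightarrow> g w) (at w within ball z r)" if "w \<in> {z}" for w
      using that tendsto_within_subset[OF tend subset_UNIV] by simp
  qed (use holo_g in auto)
  show "zorder f z = -1"
    by (rule zorder_eqI[OF open_ball _ g]) (use r c in \<open>auto simp: g_def power_int_minus field_simps\<close>)
  show "residue f z = c"
    using r holo lim by (intro residue_simple'[of "ball z r"]) auto
  have "is_pole (\<lambda>w. g w / (w - z)) z"
    using tend c by (intro is_pole_divide) (auto simp: isCont_def g_def filterlim_at eventually_at_filter intro!: tendsto_eq_intros)
  then show "is_pole f z"
    by (rule is_pole_transform) (auto simp: g_def eventually_at_filter)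
qed

text \<open>On a connected open set the difference vanishes off a sparse set or is nonzero off a
  sparse set; vanishing on the open set \<open>S\<close> rules out the latter. Only a punctured
  neighbourhood is claimed, as meromorphic functions may take arbitrary values at isolated
  points.\<close>

lemma meromorphic_eq_near:
  assumes f: "f meromorphic_on U" and g: "g meromorphic_on U" and U: "open U" "connected U"
    and S: "open S" "S \<subseteq> U" "S \<noteq> {}" "\<And>w. w \<in> S \<Longrightarrow> f w = g w" and z: "z \<in> U"
  shows "eventually (\<lambda>w. f w = g w) (at z)"
proof -
  have "(\<lambda>w. f w - g w) meromorphic_on U"
    using f g by (intro meromorphic_intros)
  from meromorphic_imp_constant_or_avoid[OF this U, of 0]
  consider "eventually (\<lambda>w. f w - g w = 0) (cosparse U)" | "eventually (\<lambda>w. f w - g w \<noteq> 0) (cosparse U)"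
    by blast
  then show ?thesis
  proof cases
    case 1
    then show ?thesis
      using U z by (auto simp: eventually_cosparse_open_eq)
  next
    case 2
    obtain p where p: "p \<in> S"
      using S by auto
    then have "eventually (\<lambda>w. f w - g w \<noteq> 0) (at p)"
      using 2 U S by (auto simp: eventually_cosparse_open_eq)
    moreover have "eventually (\<lambda>w. w \<in> S) (at p)"
      using S p by (intro eventually_at_in_open')
    ultimately have "eventually (\<lambda>w. False) (at p)"
      by eventually_elim (use S in auto)
    then show ?thesis by simp
  qed
qed

text \<open>Both functions equal the zeta integral on the half-plane to the right of the abscissa,
  an open nonempty set for the identity theorem. Later \<open>V\<close> is the whole plane and
  \<open>Z'\<close> the closed form.\<close>

lemma zeta_continuation_eq_near:
  assumes "zeta_continuation A \<delta> U Z" "zeta_continuation A \<delta> V Z'" "U \<subseteq> V" "z \<in> U"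
  shows "eventually (\<lambda>w. Z w = Z' w) (at z)"
proof -
  let ?S = "{s. Re s > abscissa A \<delta>}"
  have "of_real (abscissa A \<delta> + 1) \<in> ?S"
    by simp
  then have "?S \<noteq> {}"
    by blast
  moreover have "open ?S"
    by (rule open_halfspace_Re_gt)
  moreover have "Z' meromorphic_on U"
    using assms(2,3) meromorphic_on_subset unfolding zeta_continuation_def by blast
  ultimately show ?thesis
    using assms(1,2,4) unfolding zeta_continuation_def
    by (intro meromorphic_eq_near[of Z U Z' ?S z]) auto
qed

section \<open>Poles, orders and residues of the closed form\<close>

definition carpet_zeta :: "real \<Rightarrow> complex \<Rightarrow> complex" where
  "carpet_zeta \<delta> = (\<lambda>z. 8 / (2 powr z * z * (z - 1) * (3 powr z - 8))
                + 2 * of_real pi * (of_real \<delta> powr z / z)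
                + 4 * (of_real \<delta> powr (z - 1) / (z - 1)))"

lemma three_powr_eq_8_iff:
  "(3 :: complex) powr z = 8 \<longleftrightarrow>
     (\<exists>k :: int. z = of_real (log 3 8) + of_real (2 * pi / ln 3) * of_int k * \<i>)"
proof -
  have "(3 :: complex) powr z = exp (z * of_real (ln 3))" "8 = exp (of_real (ln 8) :: complex)"
    using Ln_of_real[of 3] by (auto simp: powr_def exp_of_real)
  then have "(3 :: complex) powr z = 8 \<longleftrightarrow> (\<exists>k :: int. z * of_real (ln 3) = of_real (ln 8) + of_int (2 * k) * of_real pi * \<i>)"
    by (simp only: exp_eq of_real_mult of_real_of_int_eq)
  moreover have "z * of_real (ln 3) = of_real (ln 8) + of_int (2 * k) * of_real pi * \<i> \<longleftrightarrow>
      z = of_real (log 3 8) + of_real (2 * pi / ln 3) * of_int k * \<i>" for k :: int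
    by (simp add: log_def field_simps)
  ultimately show ?thesis by simp
qed

text \<open>Places the critical line in Re z > 1, where the moment formulas hold and z (z - 1) has
  no zero.\<close>

lemma log_3_8_greater_1: "log 3 8 > 1"
  by (simp add: less_log_iff)

lemma meromorphic_carpet_zeta:
  assumes "\<delta> > 0"
  shows "carpet_zeta \<delta> meromorphic_on A"
proof -
  have [meromorphic_intros]: "(\<lambda>z. of_real c powr (f z) :: complex) meromorphic_on A"
    if "f analytic_on A" "c > 0" for f and c :: real
    using that by (intro analytic_on_imp_meromorphic_on analytic_intros) auto
  have "(\<lambda>z. 2 powr z :: complex) meromorphic_on A" "(\<lambda>z. 3 powr z :: complex) meromorphic_on A"
    by (intro analytic_on_imp_meromorphic_on analytic_intros; simp)+
  then show ?thesis
    using assms unfolding carpet_zeta_def by (intro meromorphic_intros analytic_intros)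
qed

text \<open>Right of 1 only the factor 3^z - 8 can vanish. Its derivative at a zero is 8 ln 3, so
  the zero is simple, and this 8 cancels the numerator in the residue.\<close>

lemma carpet_zeta_poles:
  assumes \<delta>: "\<delta> > 0" and z: "Re z > 1"
  shows "is_pole (carpet_zeta \<delta>) z \<longleftrightarrow> 3 powr z = 8"
    and "3 powr z = 8 \<Longrightarrow> zorder (carpet_zeta \<delta>) z = -1"
    and "3 powr z = 8 \<Longrightarrow> residue (carpet_zeta \<delta>) z = 2 powr (- z) / (of_real (ln 3) * z * (z - 1))"
proof -
  have nz: "z \<noteq> 0" "z \<noteq> 1"
    using z by auto
  let ?R = "\<lambda>w. 2 * of_real pi * (of_real \<delta> powr w / w) + 4 * (of_real \<delta> powr (w - 1) / (w - 1)) :: complex"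
  have R: "isCont ?R z"
    using \<delta> nz by (intro continuous_intros) auto
  have "\<not> is_pole (carpet_zeta \<delta>) z" if "3 powr z \<noteq> 8"
  proof -
    have "isCont (carpet_zeta \<delta>) z"
      using \<delta> nz that unfolding carpet_zeta_def by (intro continuous_intros) auto
    then show ?thesis
      by (simp add: isCont_def not_tendsto_and_filterlim_at_infinity[OF _ _] is_pole_def)
        (metis at_neq_bot not_tendsto_and_filterlim_at_infinity)
  qed
  moreover
  have P: "is_pole (carpet_zeta \<delta>) z \<and> zorder (carpet_zeta \<delta>) z = -1 \<and>
      residue (carpet_zeta \<delta>) z = 2 powr (- z) / (of_real (ln 3) * z * (z - 1))" if 3: "3 powr z = 8"
  proof -
    have "((\<lambda>w. 3 powr w) has_field_derivative 3 powr z * of_real (ln 3)) (at z)"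
      using Ln_of_real[of 3] by (auto intro!: derivative_eq_intros)
    then have "((\<lambda>w. (3 powr w - 8) / (w - z)) \<longlongrightarrow> 8 * of_real (ln 3)) (at z)"
      by (simp add: has_field_derivative_iff 3)
    then have "((\<lambda>w. 8 / (2 powr w * w * (w - 1)) * inverse ((3 powr w - 8) / (w - z)) + ?R w * (w - z))
        \<longlongrightarrow> 8 / (2 powr z * z * (z - 1)) * inverse (8 * of_real (ln 3)) + ?R z * (z - z)) (at z)"
      using nz \<delta> by (intro tendsto_intros R[unfolded isCont_def]) auto
    moreover have "8 / (2 powr z * z * (z - 1)) * inverse (8 * of_real (ln 3)) + ?R z * (z - z)
        = 2 powr (- z) / (of_real (ln 3) * z * (z - 1))"
      by (simp add: powr_minus field_simps)
    \<comment> \<open>The identity holds for every w: where a denominator vanishes, division by zero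
      makes the affected terms 0 on both sides.\<close>
    moreover have "eventually (\<lambda>w. 8 / (2 powr w * w * (w - 1)) * inverse ((3 powr w - 8) / (w - z)) + ?R w * (w - z)
        = carpet_zeta \<delta> w * (w - z)) (at z)"
      by (rule always_eventually) (simp add: carpet_zeta_def distrib_right mult.assoc add.assoc)
    ultimately have "((\<lambda>w. carpet_zeta \<delta> w * (w - z)) \<longlongrightarrow> 2 powr (- z) / (of_real (ln 3) * z * (z - 1))) (at z)"
      using Lim_transform_eventually by force
    moreover have "isolated_singularity_at (carpet_zeta \<delta>) z"
      using meromorphic_carpet_zeta[OF \<delta>, of UNIV] by (rule meromorphic_on_isolated_singularity[OF meromorphic_on_subset]) simp
    moreover have "2 powr (- z) / (of_real (ln 3) * z * (z - 1)) \<noteq> 0"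
      using nz by simp
    ultimately show ?thesis
      using simple_pole_of_limit by blast
  qed
  ultimately show "is_pole (carpet_zeta \<delta>) z \<longleftrightarrow> 3 powr z = 8"
    by blast
  show "3 powr z = 8 \<Longrightarrow> zorder (carpet_zeta \<delta>) z = -1"
    and "3 powr z = 8 \<Longrightarrow> residue (carpet_zeta \<delta>) z = 2 powr (- z) / (of_real (ln 3) * z * (z - 1))"
    using P by blast+
qed

section \<open>The zeta function of the carpet\<close>

context
  fixes n :: nat and r :: real
  defines "r \<equiv> 1 / (2 * 3 ^ Suc n)"
begin

text \<open>The density 8^(n+1) (r - t) is the total perimeter of 8^n squares of side 2 (r - t), and
  its integral over [t, r] is their total area.\<close>

lemma carpet_holes_level:
  assumes "0 \<le> t" "t \<le> r"
  shows "0 \<le> 8 ^ Suc n * r + (- (8 ^ Suc n)) * t"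
    and "emeasure lborel {p \<in> carpet_holes n. t < carpet_dist p}
       = ennreal (8 ^ Suc n * r * (r - t) + (- (8 ^ Suc n)) * (r\<^sup>2 - t\<^sup>2) / 2)"
proof -
  show "0 \<le> 8 ^ Suc n * r + (- (8 ^ Suc n)) * t"
    using assms by simp
  have "8 ^ Suc n * r * (r - t) + (- (8 ^ Suc n)) * (r\<^sup>2 - t\<^sup>2) / 2 = 8 ^ n * (2 * (r - t))\<^sup>2"
    by (simp add: power2_eq_square field_simps)
  then show "emeasure lborel {p \<in> carpet_holes n. t < carpet_dist p}
       = ennreal (8 ^ Suc n * r * (r - t) + (- (8 ^ Suc n)) * (r\<^sup>2 - t\<^sup>2) / 2)"
    using emeasure_carpet_holes_greater[of t n] assms unfolding r_def by presburger
qed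

lemma carpet_holes_moment:
  assumes s: "Re s > 1"
  shows "set_integrable lborel (carpet_holes n) (zeta_integrand sierpinski_carpet s)"
    and "(LINT p:carpet_holes n|lborel. zeta_integrand sierpinski_carpet s p)
       = 8 * 2 powr (- s) * 3 powr (- s) / (s * (s - 1)) * (8 * 3 powr (- s)) ^ n"
proof -
  have r: "r > 0"
    by (simp add: r_def)
  have d: "0 < carpet_dist p \<and> carpet_dist p \<le> r" if "p \<in> carpet_holes n" for p
    using carpet_holes_dist[OF that] by (simp add: r_def)
  have [measurable]: "carpet_holes n \<in> sets borel"
    using open_carpet_holes by auto
  show "set_integrable lborel (carpet_holes n) (zeta_integrand sierpinski_carpet s)"
    unfolding zeta_integrand_def by (rule distance_moment(1)[OF _ _ r d carpet_holes_level s]) auto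
  have s0: "s \<noteq> 0" "s \<noteq> 1"
    using s by auto
  have rs: "of_real r * of_real r powr (s - 1) = (of_real r powr s :: complex)"
    using r powr_add[of "of_real r" 1 "s - 1"] by simp
  have "of_real r powr s = exp (s * of_real (ln r))"
    using r by (simp add: powr_def Ln_of_real)
  also have "ln r = - ln 2 - ln 3 * real (Suc n)"
    unfolding r_def by (simp add: ln_div ln_mult ln_realpow algebra_simps del: of_nat_Suc power_Suc)
  also have "s * of_real (- ln 2 - ln 3 * real (Suc n)) = - s * of_real (ln 2) + of_nat (Suc n) * (- s * of_real (ln 3))"
    by (simp add: algebra_simps)
  also have "exp (- s * of_real (ln 2) + of_nat (Suc n) * (- s * of_real (ln 3)))
      = 2 powr (- s) * (3 powr (- s)) ^ Suc n"
  proof -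
    have "2 powr (- s) = exp (- s * of_real (ln 2))" "3 powr (- s) = exp (- s * of_real (ln 3))"
      using Ln_of_real[of 2] Ln_of_real[of 3] by (simp_all add: powr_def)
    then show ?thesis
      by (simp only: exp_add exp_of_nat_mult)
  qed
  finally have r_powr: "of_real r powr s = 2 powr (- s) * (3 powr (- s)) ^ Suc n" .
  have "(LINT p:carpet_holes n|lborel. zeta_integrand sierpinski_carpet s p)
     = of_real (8 ^ Suc n * r) * (of_real r powr (s - 1) / (s - 1)) + of_real (- (8 ^ Suc n)) * (of_real r powr s / s)"
    unfolding zeta_integrand_def by (rule distance_moment(2)[OF _ _ r d carpet_holes_level s]) auto
  also have "\<dots> = 8 ^ Suc n * (of_real r * of_real r powr (s - 1) / (s - 1)) - 8 ^ Suc n * (of_real r powr s / s)"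
    by simp
  \<comment> \<open>Partial fractions: 1/(s - 1) - 1/s = 1/(s (s - 1)).\<close>
  also have "\<dots> = 8 ^ Suc n * (of_real r powr s / (s * (s - 1)))"
    using s0 unfolding rs by (simp add: field_simps)
  also have "\<dots> = 8 * 2 powr (- s) * 3 powr (- s) / (s * (s - 1)) * (8 * 3 powr (- s)) ^ n"
    unfolding r_powr by (simp add: power_mult_distrib)
  finally show "(LINT p:carpet_holes n|lborel. zeta_integrand sierpinski_carpet s p)
     = 8 * 2 powr (- s) * 3 powr (- s) / (s * (s - 1)) * (8 * 3 powr (- s)) ^ n" .
qed

end

lemma carpet_holes_real_moment:
  fixes \<sigma> :: real
  assumes \<sigma>: "\<sigma> > 1"
  shows "(\<integral>\<^sup>+p\<in>carpet_holes n. ennreal (carpet_dist p powr (\<sigma> - 2)) \<partial>lborel)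
       = ennreal (8 * 2 powr (- \<sigma>) * 3 powr (- \<sigma>) / (\<sigma> * (\<sigma> - 1)) * (8 * 3 powr (- \<sigma>)) ^ n)"
    (is "?I = ennreal ?r")
proof -
  have eq: "indicator (carpet_holes n) p *\<^sub>R zeta_integrand sierpinski_carpet (of_real \<sigma>) p
      = of_real (indicator (carpet_holes n) p * carpet_dist p powr (\<sigma> - 2))" for p
    using powr_of_real[of "carpet_dist p" "\<sigma> - 2"] infdist_nonneg[of p sierpinski_carpet]
    by (simp add: zeta_integrand_def scaleR_conv_of_real)
  note M = carpet_holes_moment[of "of_real \<sigma>" n, unfolded set_integrable_def set_lebesgue_integral_def eq
      complex_of_real_integrable_eq integral_complex_of_real]
  have "complex_of_real (\<integral>p. indicator (carpet_holes n) p * carpet_dist p powr (\<sigma> - 2) \<partial>lborel) = of_real ?r"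
    using M(2) \<sigma> powr_of_real[of 2 "- \<sigma>"] powr_of_real[of 3 "- \<sigma>"] by simp
  then have r: "(\<integral>p. indicator (carpet_holes n) p * carpet_dist p powr (\<sigma> - 2) \<partial>lborel) = ?r"
    by (simp only: of_real_eq_iff)
  have "?I = (\<integral>\<^sup>+p. ennreal (indicator (carpet_holes n) p * carpet_dist p powr (\<sigma> - 2)) \<partial>lborel)"
    by (intro nn_integral_cong) (auto simp: indicator_def)
  also have "\<dots> = ennreal ?r"
    using M(1) r \<sigma> by (subst nn_integral_eq_integral) auto
  finally show ?thesis .
qed

text \<open>The density 4 + 2 pi t is the length of the curve at distance t around the unit square:
  four unit segments and four quarter circles of radius t.\<close>

lemma carpet_outside_moment:
  assumes s: "Re s > 1" and \<delta>: "\<delta> > 0"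
  shows "set_integrable lborel (carpet_piece \<delta> 0) (zeta_integrand sierpinski_carpet s)"
    and "(LINT p:carpet_piece \<delta> 0|lborel. zeta_integrand sierpinski_carpet s p)
       = 4 * (of_real \<delta> powr (s - 1) / (s - 1)) + 2 * of_real pi * (of_real \<delta> powr s / s)"
proof -
  have nonneg: "0 \<le> 4 + 2 * pi * t" if "0 \<le> t" for t
    using that by simp
  show "set_integrable lborel (carpet_piece \<delta> 0) (zeta_integrand sierpinski_carpet s)"
    unfolding zeta_integrand_def
    by (rule distance_moment(1)[OF _ _ \<delta> carpet_piece_outside_dist nonneg emeasure_carpet_piece_outside_greater s]) auto
  have "(LINT p:carpet_piece \<delta> 0|lborel. zeta_integrand sierpinski_carpet s p)
     = of_real 4 * (of_real \<delta> powr (s - 1) / (s - 1)) + of_real (2 * pi) * (of_real \<delta> powr s / s)"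
    unfolding zeta_integrand_def
    by (rule distance_moment(2)[OF _ _ \<delta> carpet_piece_outside_dist nonneg emeasure_carpet_piece_outside_greater s]) auto
  then show "(LINT p:carpet_piece \<delta> 0|lborel. zeta_integrand sierpinski_carpet s p)
       = 4 * (of_real \<delta> powr (s - 1) / (s - 1)) + 2 * of_real pi * (of_real \<delta> powr s / s)"
    by simp
qed

section \<open>Convergence and divergence of the real moments, and the abscissa\<close>

lemma nn_integral_disjoint_Union:
  fixes f :: "'a \<Rightarrow> ennreal"
  assumes [measurable]: "f \<in> borel_measurable M" "\<And>n. B n \<in> sets M" and disj: "disjoint_family (B :: nat \<Rightarrow> 'a set)"
  shows "(\<integral>\<^sup>+x\<in>(\<Union>n. B n). f x \<partial>M) = (\<Sum>n. \<integral>\<^sup>+x\<in>B n. f x \<partial>M)"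
proof -
  have "indicator (\<Union>n. B n) x = (\<Sum>n. indicator (B n) x :: ennreal)" for x
    using suminf_indicator[OF disj, of x] by simp
  then have "(\<integral>\<^sup>+x\<in>(\<Union>n. B n). f x \<partial>M) = (\<integral>\<^sup>+x. (\<Sum>n. f x * indicator (B n) x) \<partial>M)"
    by simp
  also have "\<dots> = (\<Sum>n. \<integral>\<^sup>+x\<in>B n. f x \<partial>M)"
    by (rule nn_integral_suminf) measurable
  finally show ?thesis .
qed

lemma disjoint_family_carpet_piece: "disjoint_family (carpet_piece \<delta>)"
  using disjoint_carpet_piece by (auto simp: disjoint_family_on_def)

text \<open>The origin of the critical exponent: the geometric series over the generations has ratio
  8 * 3^(-\<sigma>).\<close>

lemma three_powr_less_8_iff: "8 * 3 powr (- \<sigma>) < 1 \<longleftrightarrow> log 3 8 < \<sigma>" for \<sigma> :: real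
  by (simp add: powr_minus log_less_iff field_simps)

lemma carpet_outside_real_moment_finite:
  assumes "\<sigma> > 1" "\<delta> > 0"
  shows "(\<integral>\<^sup>+p\<in>carpet_piece \<delta> 0. ennreal (carpet_dist p powr (\<sigma> - 2)) \<partial>lborel) < \<infinity>"
proof -
  have nonneg: "0 \<le> 4 + 2 * pi * t" if "0 \<le> t" for t
    using that by simp
  have "(\<integral>\<^sup>+p\<in>carpet_piece \<delta> 0. ennreal (carpet_dist p powr (\<sigma> - 2)) \<partial>lborel)
    = ennreal (4 * (\<delta> powr (\<sigma> - 1) / (\<sigma> - 1)) + 2 * pi * (\<delta> powr \<sigma> / \<sigma>))"
    by (rule nn_distance_moment[OF _ _ assms(2) carpet_piece_outside_dist nonneg
        emeasure_carpet_piece_outside_greater assms(1)]) auto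
  then show ?thesis by simp
qed

lemma carpet_real_moment_finite:
  assumes \<sigma>: "\<sigma> > log 3 8" and \<delta>: "\<delta> > 0"
  shows "(\<integral>\<^sup>+p\<in>(\<Union>n. carpet_piece \<delta> n). ennreal (carpet_dist p powr (\<sigma> - 2)) \<partial>lborel) < \<infinity>"
proof -
  have 1: "\<sigma> > 1"
    using \<sigma> log_3_8_greater_1 by linarith
  let ?f = "\<lambda>n. \<integral>\<^sup>+p\<in>carpet_piece \<delta> n. ennreal (carpet_dist p powr (\<sigma> - 2)) \<partial>lborel"
  define K where "K = 8 * 2 powr (- \<sigma>) * 3 powr (- \<sigma>) / (\<sigma> * (\<sigma> - 1))"
  define q where "q = 8 * 3 powr (- \<sigma>)"
  have q: "0 < q" "q < 1" and K: "K > 0"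
    using \<sigma> 1 by (auto simp: q_def K_def three_powr_less_8_iff)
  have "(\<Sum>n. ?f (Suc n)) = (\<Sum>n. ennreal (K * q ^ n))"
    using carpet_holes_real_moment[OF 1] by (simp add: carpet_piece_def K_def q_def)
  also have "\<dots> \<noteq> \<infinity>"
    using q K by (subst suminf_ennreal2) (auto intro!: summable_mult summable_geometric)
  finally have "(\<Sum>n. ?f (Suc n)) < \<infinity>"
    by (simp add: less_top)
  moreover have "?f 0 < \<infinity>"
    by (rule carpet_outside_real_moment_finite[OF 1 \<delta>])
  moreover have "(\<Sum>n. ?f n) = ?f 0 + (\<Sum>n. ?f (Suc n))"
    using suminf_offset[of ?f 1] by simp
  ultimately show ?thesis
    by (subst nn_integral_disjoint_Union) (auto simp: disjoint_family_carpet_piece)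
qed

text \<open>For \<open>\<sigma> = log 3 8\<close> the geometric series has ratio \<open>1\<close>; smaller exponents give larger integrands since
  the distance is at most \<open>1\<close>.\<close>

lemma carpet_real_moment_infinite:
  assumes \<sigma>: "\<sigma> \<le> log 3 8"
  shows "(\<integral>\<^sup>+p\<in>(\<Union>n. carpet_holes n). ennreal (carpet_dist p powr (\<sigma> - 2)) \<partial>lborel) = \<infinity>"
proof -
  define L :: real where "L = log 3 8"
  have L: "L > 1"
    using log_3_8_greater_1 by (simp add: L_def)
  define K where "K = 8 * 2 powr (- L) * 3 powr (- L) / (L * (L - 1))"
  have K: "K > 0"
    using L by (simp add: K_def)
  have q: "8 * 3 powr (- L) = 1"
    by (simp add: L_def powr_minus)
  have [measurable]: "carpet_holes n \<in> sets borel" for n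
    using open_carpet_holes by auto
  have "\<infinity> = (\<Sum>n::nat. ennreal K)"
  proof (rule ccontr)
    assume "\<infinity> \<noteq> (\<Sum>n::nat. ennreal K)"
    then have "summable (\<lambda>n::nat. K)"
      using K by (intro summable_suminf_not_top) auto
    then show False
      using K by (simp add: summable_const_iff)
  qed
  also have "\<dots> = (\<Sum>n. \<integral>\<^sup>+p\<in>carpet_holes n. ennreal (carpet_dist p powr (L - 2)) \<partial>lborel)"
    unfolding carpet_holes_real_moment[OF L] q by (simp add: K_def)
  also have "\<dots> = (\<integral>\<^sup>+p\<in>(\<Union>n. carpet_holes n). ennreal (carpet_dist p powr (L - 2)) \<partial>lborel)"
    using disjoint_carpet_holes by (intro nn_integral_disjoint_Union[symmetric]) (auto simp: disjoint_family_on_def)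
  also have "\<dots> \<le> (\<integral>\<^sup>+p\<in>(\<Union>n. carpet_holes n). ennreal (carpet_dist p powr (\<sigma> - 2)) \<partial>lborel)"
  proof (intro nn_integral_mono)
    fix p :: "real \<times> real"
    have "carpet_dist p powr (L - 2) \<le> carpet_dist p powr (\<sigma> - 2)" if "p \<in> carpet_holes n" for n
    proof -
      have "carpet_dist p \<le> 1 / (2 * 3 ^ Suc n)"
        using carpet_holes_dist(2)[OF that] .
      also have "\<dots> \<le> 1"
      proof -
        have "(1 :: real) \<le> 3 ^ Suc n"
          by (rule one_le_power) simp
        then have "1 \<le> 2 * (3 :: real) ^ Suc n"
          by linarith
        then show ?thesis
          by simp
      qed
      finally show ?thesis
        using carpet_holes_dist(1)[OF that] \<sigma> by (intro powr_mono') (auto simp: L_def)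
    qed
    then show "ennreal (carpet_dist p powr (L - 2)) * indicator (\<Union>n. carpet_holes n) p
        \<le> ennreal (carpet_dist p powr (\<sigma> - 2)) * indicator (\<Union>n. carpet_holes n) p"
      by (auto simp: indicator_def)
  qed
  finally show ?thesis
    by (simp add: top.extremum_unique)
qed

text \<open>Both claims discard the carpet as a null set. The second one disposes of the branch with
  value \<infinity> in \<open>abscissa\<close>.\<close>

lemma AE_nbhd_carpet:
  assumes "\<delta> > 1 / 6"
  shows "AE p in lborel. p \<in> nbhd sierpinski_carpet \<delta> \<longleftrightarrow> p \<in> (\<Union>n. carpet_piece \<delta> n)"
    and "AE p in lborel. carpet_dist p \<noteq> 0"
proof -
  have "AE p in lborel. p \<notin> sierpinski_carpet"
    by (rule AE_not_in[OF null_sierpinski_carpet])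
  then show "AE p in lborel. p \<in> nbhd sierpinski_carpet \<delta> \<longleftrightarrow> p \<in> (\<Union>n. carpet_piece \<delta> n)"
    and "AE p in lborel. carpet_dist p \<noteq> 0"
    unfolding nbhd_carpet_eq[OF assms] using carpet_dist_pos_iff by (auto elim!: eventually_mono simp: less_le)
qed

text \<open>The admissible exponents form exactly the open ray above \<open>log 3 8\<close>: the
  holes alone force divergence up to and including that value, and beyond it holes and collar
  together converge. The infimum is not attained.\<close>

lemma abscissa_carpet:
  assumes "\<delta> > 1 / 6"
  shows "abscissa sierpinski_carpet \<delta> = log 3 8"
proof -
  let ?g = "\<lambda>\<sigma> p. if carpet_dist p = 0 \<and> \<sigma> < 2 then \<infinity> else ennreal (carpet_dist p powr (\<sigma> - 2))"
  have eq: "(\<integral>\<^sup>+p\<in>nbhd sierpinski_carpet \<delta>. ?g \<sigma> p \<partial>lborel)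
      = (\<integral>\<^sup>+p\<in>(\<Union>n. carpet_piece \<delta> n). ennreal (carpet_dist p powr (\<sigma> - 2)) \<partial>lborel)" for \<sigma>
  proof (rule nn_integral_cong_AE)
    show "AE p in lborel. ?g \<sigma> p * indicator (nbhd sierpinski_carpet \<delta>) p
        = ennreal (carpet_dist p powr (\<sigma> - 2)) * indicator (\<Union>n. carpet_piece \<delta> n) p"
      using AE_nbhd_carpet[OF assms] by eventually_elim (simp add: indicator_def)
  qed
  have "(\<Union>n. carpet_holes n) \<subseteq> (\<Union>n. carpet_piece \<delta> n)"
    by (auto simp: carpet_piece_def intro!: exI[of _ "Suc _"])
  then have le: "(\<integral>\<^sup>+p\<in>(\<Union>n. carpet_holes n). ennreal (carpet_dist p powr (\<sigma> - 2)) \<partial>lborel)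
      \<le> (\<integral>\<^sup>+p\<in>nbhd sierpinski_carpet \<delta>. ?g \<sigma> p \<partial>lborel)" for \<sigma>
    unfolding eq by (rule nn_set_integral_set_mono)
  have "\<not> (\<integral>\<^sup>+p\<in>nbhd sierpinski_carpet \<delta>. ?g \<sigma> p \<partial>lborel) < \<infinity>" if "\<sigma> \<le> log 3 8" for \<sigma>
    using le[of \<sigma>] by (simp only: carpet_real_moment_infinite[OF that] not_less)
  moreover have "(\<integral>\<^sup>+p\<in>nbhd sierpinski_carpet \<delta>. ?g \<sigma> p \<partial>lborel) < \<infinity>" if "\<sigma> > log 3 8" for \<sigma>
    unfolding eq using carpet_real_moment_finite[OF that] assms by simp
  moreover have "\<sigma> \<ge> 0" if "\<sigma> > log 3 8" for \<sigma>
    using that log_3_8_greater_1 by linarith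
  ultimately have "{\<sigma>. 0 \<le> \<sigma> \<and> (\<integral>\<^sup>+p\<in>nbhd sierpinski_carpet \<delta>. ?g \<sigma> p \<partial>lborel) < \<infinity>} = {log 3 8<..}"
    by (auto simp: not_le[symmetric])
  then show ?thesis
    unfolding abscissa_def by simp
qed

section \<open>The zeta integral, its continuation and the principal poles\<close>

lemma measurable_zeta_integrand [measurable]: "zeta_integrand A s \<in> borel_measurable borel"
  unfolding zeta_integrand_def[abs_def] by measurable

text \<open>The norm of the integrand is bounded by the real power with exponent Re s - 2, so the
  finite real moment gives integrability over the union of the pieces; this licenses integrating
  piece by piece.\<close>

lemma carpet_zeta_integral:
  assumes \<delta>: "\<delta> > 1 / 6" and s: "Re s > log 3 8"
  shows "set_integrable lborel (nbhd sierpinski_carpet \<delta>) (zeta_integrand sierpinski_carpet s)"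
    and "distance_zeta sierpinski_carpet \<delta> s = carpet_zeta \<delta> s"
proof -
  have 1: "Re s > 1"
    using s log_3_8_greater_1 by linarith
  let ?U = "\<Union>n. carpet_piece \<delta> n"
  have nbhd [measurable]: "nbhd sierpinski_carpet \<delta> \<in> sets borel"
    unfolding nbhd_def by measurable
  have "(\<integral>\<^sup>+p. norm (indicator ?U p *\<^sub>R zeta_integrand sierpinski_carpet s p) \<partial>lborel)
     \<le> (\<integral>\<^sup>+p\<in>?U. ennreal (carpet_dist p powr (Re s - 2)) \<partial>lborel)"
    by (intro nn_integral_mono) (auto simp: indicator_def zeta_integrand_def norm_powr_real_powr infdist_nonneg)
  also have "\<dots> < \<infinity>"
    using carpet_real_moment_finite[OF s] \<delta> by simp
  finally have int: "set_integrable lborel ?U (zeta_integrand sierpinski_carpet s)"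
    unfolding set_integrable_def by (intro integrableI_bounded) auto
  then show "set_integrable lborel (nbhd sierpinski_carpet \<delta>) (zeta_integrand sierpinski_carpet s)"
    unfolding set_integrable_def
    by (rule integrable_cong_AE_imp) (use AE_nbhd_carpet(1)[OF \<delta>] in \<open>auto elim!: eventually_mono simp: indicator_def\<close>)
  have "distance_zeta sierpinski_carpet \<delta> s = (LINT p:?U|lborel. zeta_integrand sierpinski_carpet s p)"
    unfolding distance_zeta_def
    by (intro set_integral_cong_set) (use AE_nbhd_carpet(1)[OF \<delta>] in \<open>auto simp: set_borel_measurable_def elim!: eventually_mono\<close>)
  also have "\<dots> = (\<Sum>n. LINT p:carpet_piece \<delta> n|lborel. zeta_integrand sierpinski_carpet s p)"
    using int disjoint_carpet_piece by (intro lebesgue_integral_countable_add) auto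
  also have "\<dots> = carpet_zeta \<delta> s"
  proof (rule sums_unique[symmetric])
    let ?I = "\<lambda>n. LINT p:carpet_piece \<delta> n|lborel. zeta_integrand sierpinski_carpet s p"
    let ?K = "8 * 2 powr (- s) * 3 powr (- s) / (s * (s - 1))"
    let ?q = "8 * 3 powr (- s)"
    have q: "norm ?q < 1"
      using s three_powr_less_8_iff[of "Re s"] by (simp add: norm_mult norm_powr_real_powr)
    have "(\<lambda>n. ?K * ?q ^ n) sums (?K * (1 / (1 - ?q)))"
      by (intro sums_mult geometric_sums q)
    also have "(\<lambda>n. ?K * ?q ^ n) = (\<lambda>n. ?I (Suc n))"
      using carpet_holes_moment(2)[OF 1] by (simp add: carpet_piece_def)
    finally have "?I sums (?K * (1 / (1 - ?q)) + ?I 0)"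
      by (rule sums_Suc)
    also have "?K * (1 / (1 - ?q)) + ?I 0 = carpet_zeta \<delta> s"
    proof -
      \<comment> \<open>The ratio has norm below 1, hence is not 1; this allows clearing 3^(-s) from
        1 / (1 - 8 * 3^(-s)).\<close>
      have "3 powr s \<noteq> (8 :: complex)"
        using q by (auto simp: powr_minus)
      then have "?K * (1 / (1 - ?q)) = 8 / (2 powr s * s * (s - 1) * (3 powr s - 8))"
        using 1 by (auto simp: powr_minus divide_simps)
      then show ?thesis
        using carpet_outside_moment(2)[OF 1, of \<delta>] \<delta> by (simp add: carpet_zeta_def)
    qed
    finally show "?I sums carpet_zeta \<delta> s" .
  qed
  finally show "distance_zeta sierpinski_carpet \<delta> s = carpet_zeta \<delta> s" .
qed

lemma zeta_continuation_carpet: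
  assumes "\<delta> > 1 / 6"
  shows "zeta_continuation sierpinski_carpet \<delta> UNIV (carpet_zeta \<delta>)"
  unfolding zeta_continuation_def abscissa_carpet[OF assms]
  using carpet_zeta_integral[OF assms] meromorphic_carpet_zeta[of \<delta>] assms by auto

lemma principal_complex_dims_carpet:
  assumes \<delta>: "\<delta> > 1 / 6"
  shows "principal_complex_dims sierpinski_carpet \<delta> = {z. 3 powr z = 8}"
proof -
  have Re: "Re z = log 3 8" if "3 powr z = 8" for z
    using that unfolding three_powr_eq_8_iff by auto
  have pole: "is_pole (carpet_zeta \<delta>) z \<longleftrightarrow> 3 powr z = 8" if "Re z = log 3 8" for z
    using carpet_zeta_poles(1)[of \<delta> z] that \<delta> log_3_8_greater_1 by simp
  show ?thesis
  proof (intro equalityI subsetI CollectI)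
    fix z assume "z \<in> principal_complex_dims sierpinski_carpet \<delta>"
    then obtain U Z where z: "Re z = log 3 8" "{s. Re s \<ge> log 3 8} \<subseteq> U"
      "zeta_continuation sierpinski_carpet \<delta> U Z" "is_pole Z z"
      unfolding principal_complex_dims_def abscissa_carpet[OF \<delta>] by blast
    then have "eventually (\<lambda>w. Z w = carpet_zeta \<delta> w) (at z)"
      by (intro zeta_continuation_eq_near[OF _ zeta_continuation_carpet[OF \<delta>]]) auto
    then show "3 powr z = 8"
      using z pole is_pole_cong by blast
  next
    fix z assume "z \<in> {z. 3 powr z = (8 :: complex)}"
    then show "z \<in> principal_complex_dims sierpinski_carpet \<delta>"
      unfolding principal_complex_dims_def abscissa_carpet[OF \<delta>]
      using Re pole zeta_continuation_carpet[OF \<delta>] by blast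
  qed
qed

theorem proposition3p8:
  fixes \<delta> :: real and s :: "int \<Rightarrow> complex"
  assumes "\<delta> > 1 / 6"
  defines "s \<equiv> \<lambda>k. of_real (log 3 8) + of_real (2 * pi / ln 3) * of_int k * \<i>"
  shows "zeta_continuation sierpinski_carpet \<delta> UNIV
           (\<lambda>z. 8 / (2 powr z * z * (z - 1) * (3 powr z - 8))
                + 2 * of_real pi * (of_real \<delta> powr z / z)
                + 4 * (of_real \<delta> powr (z - 1) / (z - 1)))
       \<and> principal_complex_dims sierpinski_carpet \<delta> = range s
       \<and> (\<forall>Z. zeta_continuation sierpinski_carpet \<delta> UNIV Z \<longrightarrow>
            (\<forall>\<omega>\<in>principal_complex_dims sierpinski_carpet \<delta>. is_pole Z \<omega> \<and> zorder Z \<omega> = -1)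
          \<and> (\<forall>k. residue Z (s k) = 2 powr (- s k) / (of_real (ln 3) * s k * (s k - 1))))"
proof (intro conjI allI impI)
  show "zeta_continuation sierpinski_carpet \<delta> UNIV
           (\<lambda>z. 8 / (2 powr z * z * (z - 1) * (3 powr z - 8))
                + 2 * of_real pi * (of_real \<delta> powr z / z)
                + 4 * (of_real \<delta> powr (z - 1) / (z - 1)))"
    using zeta_continuation_carpet[OF assms(1)] by (simp only: carpet_zeta_def)
  have dims: "principal_complex_dims sierpinski_carpet \<delta> = {z. 3 powr z = 8}"
    by (rule principal_complex_dims_carpet[OF assms(1)])
  have range: "{z. 3 powr z = 8} = range s"
    unfolding s_def three_powr_eq_8_iff by auto
  then show "principal_complex_dims sierpinski_carpet \<delta> = range s"
    unfolding dims .
  have s: "3 powr s k = 8" "Re (s k) > 1" for k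
    using range log_3_8_greater_1 by (auto simp: s_def)
  fix Z assume Z: "zeta_continuation sierpinski_carpet \<delta> UNIV Z"
  \<comment> \<open>Poles, orders and residues depend only on a punctured neighbourhood, so they
    transfer from the closed form to an arbitrary \<open>Z\<close>.\<close>
  have ev: "eventually (\<lambda>w. Z w = carpet_zeta \<delta> w) (at z)" for z
    using zeta_continuation_eq_near[OF Z zeta_continuation_carpet[OF assms(1)]] by simp
  have pole: "is_pole Z (s k) \<and> zorder Z (s k) = -1" for k
    using carpet_zeta_poles(1,2)[of \<delta> "s k"] s[of k] assms(1)
      is_pole_cong[OF ev refl] zorder_cong[OF ev refl] by simp
  show "\<forall>\<omega>\<in>principal_complex_dims sierpinski_carpet \<delta>. is_pole Z \<omega> \<and> zorder Z \<omega> = -1"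
    unfolding dims range using pole by blast
  show "residue Z (s k) = 2 powr (- s k) / (of_real (ln 3) * s k * (s k - 1))" for k
    using carpet_zeta_poles(3)[of \<delta> "s k"] s[of k] assms(1) residue_cong[OF ev refl] by simp
qed

end
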